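(* Let $f:\mathbb{C}\to\widehat{\mathbb{C}}$ be a transcendental meromorphic map and let $U$ be a Fatou component of $f$. For $n\ge 0$ denote by $U_n$ the Fatou component of $f$ such that $f^n(U)\subset U_n$. Then for every $z\in U$ there exists a sequence $p_n\in P(f)$ such that $$\frac{\operatorname{dist}(p_n,U_n)}{\operatorname{dist}(f^n(z),\partial U_n)}\to 0\quad\text{as } n\to\infty.$$ In particular, if for some $d>0$ we have $\operatorname{dist}(f^n(z),\partial U_n)<d$ for all $n$ (for instance, if the diameter of $U_n$ is uniformly bounded), then $\operatorname{dist}(p_n,U_n)\to 0$ as $n\to\infty$.
   Context: $\widehat{\mathbb{C}}$ is the Riemann sphere. $\operatorname{dist}$ denotes Euclidean distance, diameters are Euclidean, and $\partial U_n$ is the boundary in $\mathbb{C}$. For a meromorphic map $f:\mathbb{C}\to\widehat{\mathbb{C}}$, the Fatou set $F(f)$ is the set of points having a neighborhood on which all iterates $f^n$, $n>0$, are well defined and form a normal family; the Julia set is $J(f)=\widehat{\mathbb{C}}\setminus F(f)$. A Fatou component is a connected component of $F(f)$. Transcendental means that $\infty$ is an essential singularity of $f$. $S(f)\subset\mathbb{C}$ is the set of finite singular values of $f$, i.e. finite critical values and finite asymptotic values. The postsingular set is $$P(f)=\mathbb{C}\cap\bigcup_{s\in\overline{S(f)}}\bigcup_{n=0}^\infty f^n(s),$$ where terms that are undefined or infinite are neglected. *)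

theory Defs
  imports "HOL-Complex_Analysis.Complex_Analysis"
begin

text \<open>
  The Riemann sphere is represented by the type \<^typ>\<open>complex option\<close>, where \<^term>\<open>None\<close> stands for
  infinity. A meromorphic map from the plane to the sphere is given by a function
  \<open>f :: complex \<Rightarrow> complex\<close> with \<open>f nicely_meromorphic_on UNIV\<close> (no removable
  singularities; the value at a pole is the dummy \<open>0\<close>); the sphere-valued map
  itself is \<open>sphere_map f\<close>.
\<close>

definition sphere_map :: "(complex \<Rightarrow> complex) \<Rightarrow> complex \<Rightarrow> complex option" where
  "sphere_map f z = (if is_pole f z then None else Some (f z))"

text \<open>
  Inverse stereographic projection onto the unit sphere of \<open>\<complex> \<times> \<real>\<close>, with infinity going to the
  north pole. Convergence in the Riemann sphere is convergence after applying \<open>stereo\<close>; the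
  metric induced by \<open>stereo\<close> is the chordal metric.
\<close>

definition stereo :: "complex option \<Rightarrow> complex \<times> real" where
  "stereo w = (case w of
      None \<Rightarrow> (0, 1)
    | Some z \<Rightarrow> ((2 / ((cmod z)\<^sup>2 + 1)) *\<^sub>R z, ((cmod z)\<^sup>2 - 1) / ((cmod z)\<^sup>2 + 1)))"

text \<open>
  Infinity is an essential singularity of \<open>f\<close>. If the poles of \<open>f\<close> accumulate at infinity, this
  singularity is not isolated; the condition then holds, since \<open>f\<close> takes arbitrarily
  large values and the value \<open>0\<close> (at poles) in every neighbourhood of infinity.
\<close>

definition transcendental :: "(complex \<Rightarrow> complex) \<Rightarrow> bool" where
  "transcendental f \<longleftrightarrow> \<not> not_essential (\<lambda>w. f (1 / w)) 0"

text \<open>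
  \<open>iter f n z\<close> is the \<open>n\<close>-th iterate as a point of the sphere. As \<open>f\<close> is undefined
  at infinity, the iterate is well defined iff all the earlier ones are finite. Undefined iterates
  get the value \<^term>\<open>None\<close> too; \<open>iter_defined\<close> tells the two situations apart.
\<close>

primrec iter :: "(complex \<Rightarrow> complex) \<Rightarrow> nat \<Rightarrow> complex \<Rightarrow> complex option" where
  "iter f 0 z = Some z"
| "iter f (Suc n) z = Option.bind (iter f n z) (sphere_map f)"

definition iter_defined :: "(complex \<Rightarrow> complex) \<Rightarrow> nat \<Rightarrow> complex \<Rightarrow> bool" where
  "iter_defined f n z \<longleftrightarrow> (\<forall>k<n. iter f k z \<noteq> None)"

text \<open>
  Normality of a family of maps from \<open>V\<close> to the sphere: every sequence in the family has a
  subsequence that converges spherically, uniformly on compact subsets of \<open>V\<close>. The limit may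
  take the value infinity.
\<close>

definition normal_family_on :: "complex set \<Rightarrow> (complex \<Rightarrow> complex option) set \<Rightarrow> bool" where
  "normal_family_on V \<F> \<longleftrightarrow>
     (\<forall>s :: nat \<Rightarrow> complex \<Rightarrow> complex option. range s \<subseteq> \<F> \<longrightarrow>
        (\<exists>(r :: nat \<Rightarrow> nat) (g :: complex \<Rightarrow> complex option). strict_mono r \<and>
           (\<forall>K. compact K \<and> K \<subseteq> V \<longrightarrow>
              uniform_limit K (\<lambda>n z. stereo (s (r n) z)) (\<lambda>z. stereo (g z)) sequentially)))"

text \<open>
  Infinity never belongs to the Fatou set, as \<open>f\<close> is undefined there; so the Fatou set
  is a set of complex numbers.
\<close>

definition fatou_set :: "(complex \<Rightarrow> complex) \<Rightarrow> complex set" where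
  "fatou_set f = {z. \<exists>V. open V \<and> z \<in> V \<and>
     (\<forall>n>0. \<forall>w\<in>V. iter_defined f n w) \<and> normal_family_on V {iter f n | n. n > 0}}"

definition critical_values :: "(complex \<Rightarrow> complex) \<Rightarrow> complex set" where
  "critical_values f = {f c | c. \<not> is_pole f c \<and> deriv f c = 0}"

definition asymptotic_values :: "(complex \<Rightarrow> complex) \<Rightarrow> complex set" where
  "asymptotic_values f = {a. \<exists>\<gamma> :: real \<Rightarrow> complex.
     continuous_on {0..} \<gamma> \<and> filterlim \<gamma> at_infinity at_top \<and>
     ((\<lambda>t. stereo (sphere_map f (\<gamma> t))) \<longlongrightarrow> stereo (Some a)) at_top}"

definition singular_values :: "(complex \<Rightarrow> complex) \<Rightarrow> complex set" where
  "singular_values f = critical_values f \<union> asymptotic_values f"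

text \<open>
  The closure is taken in the plane. Closing up in the sphere could only add the point infinity,
  whose iterates are infinite or undefined and hence contribute nothing.
\<close>

definition postsingular_set :: "(complex \<Rightarrow> complex) \<Rightarrow> complex set" where
  "postsingular_set f = {w. \<exists>s \<in> closure (singular_values f). \<exists>n. iter f n s = Some w}"

end

theory Submission
  imports Defs "HOL-Real_Asymp.Real_Asymp"
begin

text \<open>
  Suppose that for infinitely many \<open>n\<close> no postsingular point is within distance
  \<open>c * infdist (f\<^sup>n z) (frontier (W n))\<close> of \<open>W n\<close>. Then a disc about \<open>f\<^sup>n z\<close> that is larger by the factor
  \<open>1 + c\<close> than the one reaching to the boundary of \<open>W n\<close> avoids the postsingular set, so that the branch
  of the inverse of \<open>f\<^sup>n\<close> taking \<open>f\<^sup>n z\<close> to \<open>z\<close> exists on it. Rescaled to the unit disc, these branches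
  \<open>H\<^sub>n\<close> omit the postsingular set, which has at least two points; so by Montel a subsequence converges to
  some \<open>G\<close> with \<open>G 0 = z\<close>. As the discs contain, well inside, boundary points of \<open>W n\<close>, the image of \<open>G\<close>
  contains a point outside the Fatou set, and \<open>G\<close> is an open map. By Hurwitz each point of its image is
  in the range of infinitely many \<open>H\<^sub>n\<close>, so that all its iterates are finite and avoid the postsingular
  set. By Montel the image of \<open>G\<close> thus lies in the Fatou set, a contradiction.

  The inverse branches exist without any covering theory: a lift of a path through \<open>f\<close> can only fail
  to extend if it tends to infinity, which gives an asymptotic value, or ends at a critical point.
\<close>

section \<open>Lifting through meromorphic maps\<close>

lemma holomorphic_glue:
  fixes D :: "'i \<Rightarrow> complex set"
  assumes op: "\<And>i. i \<in> I \<Longrightarrow> open (D i)"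
    and hol: "\<And>i. i \<in> I \<Longrightarrow> g i holomorphic_on D i"
    and agree: "\<And>i j x. \<lbrakk>i \<in> I; j \<in> I; x \<in> D i; x \<in> D j\<rbrakk> \<Longrightarrow> g i x = g j x"
  obtains H where "H holomorphic_on (\<Union>i\<in>I. D i)" "\<And>i x. \<lbrakk>i \<in> I; x \<in> D i\<rbrakk> \<Longrightarrow> H x = g i x"
proof -
  define H where "H x = g (SOME i. i \<in> I \<and> x \<in> D i) x" for x
  have eq: "H x = g i x" if "i \<in> I" "x \<in> D i" for i x
  proof -
    have "(SOME i. i \<in> I \<and> x \<in> D i) \<in> I \<and> x \<in> D (SOME i. i \<in> I \<and> x \<in> D i)"
      by (rule someI[of _ i]) (use that in auto)
    then show ?thesis
      using that agree unfolding H_def by blast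
  qed
  have "H holomorphic_on D i" if "i \<in> I" for i
    using hol[OF that] eq[OF that] holomorphic_cong by metis
  then have "H holomorphic_on (\<Union>i\<in>I. D i)"
    by (intro holomorphic_on_UN_open op)
  with eq that show thesis by blast
qed

lemma nicely_meromorphic_holomorphic:
  assumes "f nicely_meromorphic_on UNIV" "\<And>x. x \<in> A \<Longrightarrow> \<not> is_pole f x"
  shows "f holomorphic_on A"
  using nicely_meromorphic_on_imp_analytic_at[OF assms(1)] assms(2)
  by (meson analytic_imp_holomorphic analytic_on_analytic_at UNIV_I)

lemma open_nonpoles:
  assumes "f nicely_meromorphic_on UNIV"
  shows "open {x. \<not> is_pole f x}"
proof -
  have "{z. is_pole f z} sparse_in UNIV"
    using assms
    by (meson meromorphic_on_isolated_singularity meromorphic_on_meromorphic_at nicely_meromorphic_on_def not_islimpt_poles open_UNIV sparse_in_open)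
  then have "open (UNIV - {z. is_pole f z})"
    by (rule open_diff_sparse_pts[rotated]) auto
  then show ?thesis
    by (simp add: Compl_eq_Diff_UNIV[symmetric] Collect_neg_eq)
qed

lemma nicely_meromorphic_isCont:
  assumes "f nicely_meromorphic_on UNIV" "\<not> is_pole f z"
  shows "isCont f z"
  using nicely_meromorphic_on_imp_analytic_at[OF assms(1)] assms(2) analytic_at_imp_isCont by blast

lemma local_inverse:
  assumes "f nicely_meromorphic_on UNIV" "\<not> is_pole f q" "deriv f q \<noteq> 0"
  obtains e g where "e > 0" "inj_on f (ball q e)" "\<And>x. x \<in> ball q e \<Longrightarrow> \<not> is_pole f x"
    "open (f ` ball q e)" "g holomorphic_on f ` ball q e"
    "\<And>x. x \<in> ball q e \<Longrightarrow> g (f x) = x"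
proof -
  obtain e where e: "e > 0" "ball q e \<subseteq> {x. \<not> is_pole f x}" "inj_on f (ball q e)"
    using has_complex_derivative_locally_injective[of f "{x. \<not> is_pole f x}" q]
      nicely_meromorphic_holomorphic[OF assms(1)] open_nonpoles[OF assms(1)] assms
    by (metis (mono_tags, lifting) mem_Collect_eq)
  have hol: "f holomorphic_on ball q e"
    using nicely_meromorphic_holomorphic[OF assms(1)] e(2) by blast
  obtain g where g: "g holomorphic_on (f ` ball q e)" "\<And>z. z \<in> ball q e \<Longrightarrow> g(f z) = z"
    using holomorphic_has_inverse[OF hol _ e(3)] open_ball by metis
  have "open (f ` ball q e)"
    using open_mapping_thm3[OF hol open_ball e(3)] .
  with e g that show thesis by blast
qed

text \<open>The two maps share a value at \<open>x0\<close>, near which \<open>f\<close> is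
  injective. So they agree on the neighbourhood \<open>N\<close> of \<open>x0\<close>, and the
  identity theorem does the rest.\<close>

lemma unique_lift:
  assumes f: "f nicely_meromorphic_on UNIV"
    and D: "open D" "connected D" "x0 \<in> D"
    and H: "H holomorphic_on D" "H' holomorphic_on D"
    and eq: "\<And>x. x \<in> D \<Longrightarrow> f (H x) = f (H' x)" "H x0 = H' x0"
    and reg: "\<not> is_pole f (H x0)" "deriv f (H x0) \<noteq> 0"
    and x: "x \<in> D"
  shows "H x = H' x"
proof -
  obtain e g where e: "e > 0" "\<And>x. x \<in> ball (H x0) e \<Longrightarrow> g (f x) = x"
    using local_inverse[OF f reg] by metis
  define N where "N = (D \<inter> H -` ball (H x0) e) \<inter> (D \<inter> H' -` ball (H x0) e)"
  have "open N"
    unfolding N_def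
    using H D holomorphic_on_imp_continuous_on continuous_open_preimage
    by (metis open_Int open_ball)
  moreover have "x0 \<in> N" using e D eq by (auto simp: N_def)
  moreover have "H y = H' y" if "y \<in> N" for y
    using that e(2) eq(1) unfolding N_def by (metis IntE vimageE)
  moreover have "N \<subseteq> D" by (auto simp: N_def)
  ultimately show ?thesis
    using D H x by (intro analytic_continuation_open[of N D H H' x]) blast+
qed

section \<open>Ends of lifted paths\<close>

lemma continuous_on_stereo_Some: "continuous_on UNIV (\<lambda>z. stereo (Some z))"
proof -
  have "(cmod z)\<^sup>2 + 1 \<noteq> 0" for z :: complex
    by (smt (verit) zero_le_power2)
  then show ?thesis
    unfolding stereo_def by (auto intro!: continuous_intros)
qed

text \<open>If \<open>\<gamma>\<close> tended to infinity, \<open>v\<close> would be an asymptotic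
  value; so \<open>\<gamma>\<close> has a finite accumulation point \<open>q\<close>. There
  \<open>f\<close> has no pole, since its values along \<open>\<gamma>\<close> are close to
  \<open>v\<close>, and no critical point, since \<open>v\<close> is no critical value. Hence
  \<open>f\<close> is injective near \<open>q\<close> and stays away from \<open>v\<close> on small
  circles about \<open>q\<close>. At late times \<open>\<gamma>\<close> cannot cross these, and so
  it converges to \<open>q\<close>.\<close>

lemma path_lift_converges:
  fixes \<gamma> :: "real \<Rightarrow> complex"
  assumes f: "f nicely_meromorphic_on UNIV"
    and cont: "continuous_on {0..<1} \<gamma>"
    and np: "\<And>t. t \<in> {0..<1} \<Longrightarrow> \<not> is_pole f (\<gamma> t)"
    and lim: "((\<lambda>t. f (\<gamma> t)) \<longlongrightarrow> v) (at_left 1)"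
    and v: "v \<notin> singular_values f"
  obtains q where "\<not> is_pole f q" "f q = v" "deriv f q \<noteq> 0" "(\<gamma> \<longlongrightarrow> q) (at_left 1)"
proof -
  have ninf: "\<not> filterlim \<gamma> at_infinity (at_left 1)"
  proof
    assume inf: "filterlim \<gamma> at_infinity (at_left 1)"
    \<comment> \<open>Asymptotic values are defined by paths over \<open>{0..}\<close>;
      \<open>\<tau>\<close> maps this half-line onto \<open>{0..<1}\<close>.\<close>
    define \<tau> where "\<tau> s = 1 - 1 / (s + 1)" for s :: real
    have \<tau>: "filterlim \<tau> (at_left 1) at_top"
      unfolding \<tau>_def by real_asymp
    have \<tau>01: "\<tau> s \<in> {0..<1}" if "s \<ge> 0" for s
      using that by (auto simp: \<tau>_def)
    have "continuous_on {0..} \<tau>"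
      unfolding \<tau>_def by (auto intro!: continuous_intros)
    then have "continuous_on {0..} (\<gamma> \<circ> \<tau>)"
      by (intro continuous_on_compose) (auto intro!: continuous_on_subset[OF cont] \<tau>01[THEN subsetD[OF subset_refl]] simp del: atLeastLessThan_iff)
    moreover have "filterlim (\<gamma> \<circ> \<tau>) at_infinity at_top"
      using filterlim_compose[OF inf \<tau>] by (simp add: o_def)
    moreover have "((\<lambda>t. stereo (sphere_map f ((\<gamma> \<circ> \<tau>) t))) \<longlongrightarrow> stereo (Some v)) at_top"
    proof -
      have "((\<lambda>t. f (\<gamma> (\<tau> t))) \<longlongrightarrow> v) at_top"
        using filterlim_compose[OF lim \<tau>] .
      then have "((\<lambda>t. stereo (Some (f (\<gamma> (\<tau> t))))) \<longlongrightarrow> stereo (Some v)) at_top"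
        by (rule continuous_on_tendsto_compose[OF continuous_on_stereo_Some]) auto
      moreover have "eventually (\<lambda>t. stereo (Some (f (\<gamma> (\<tau> t)))) = stereo (sphere_map f ((\<gamma> \<circ> \<tau>) t))) at_top"
        using eventually_ge_at_top[of 0]
        by eventually_elim (use np \<tau>01 in \<open>auto simp: sphere_map_def simp del: atLeastLessThan_iff\<close>)
      ultimately show ?thesis
        by (rule Lim_transform_eventually)
    qed
    ultimately have "v \<in> asymptotic_values f"
      unfolding asymptotic_values_def by blast
    with v show False by (simp add: singular_values_def)
  qed
  then obtain M where "\<not> (\<forall>\<^sub>F t in at_left 1. M \<le> norm (\<gamma> t))"
    unfolding filterlim_at_infinity_conv_norm_at_top filterlim_at_top by blast
  then have M: "\<exists>\<^sub>F t in at_left 1. norm (\<gamma> t) < M"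
    by (simp add: not_eventually not_le)
  have "\<exists>t. t \<in> {0..<1} \<and> 1 - t < 1 / real (Suc n) \<and> norm (\<gamma> t) < M" for n
  proof -
    define c where "c = 1 - 1 / real (Suc n)"
    have c: "0 \<le> c" "c < 1" by (auto simp: c_def)
    have "eventually (\<lambda>t. t \<in> {0..<1} \<and> 1 - t < 1 / real (Suc n)) (at_left (1::real))"
      unfolding eventually_at_left_field
    proof (intro exI[of _ c] conjI impI allI)
      fix y assume "c < y" "y < 1"
      with c(1) show "y \<in> {0..<1}" by simp
      from \<open>c < y\<close> show "1 - y < 1 / real (Suc n)" by (simp add: c_def del: of_nat_Suc)
    qed (use c in simp)
    then have "\<exists>\<^sub>F t in at_left 1. norm (\<gamma> t) < M \<and> t \<in> {0..<1} \<and> 1 - t < 1 / real (Suc n)"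
      by (rule frequently_eventually_frequently[OF M])
    from frequently_ex[OF this] show ?thesis by blast
  qed
  then obtain t where t: "\<And>n. t n \<in> {0..<1}" "\<And>n. 1 - t n < 1 / real (Suc n)" "\<And>n. norm (\<gamma> (t n)) < M"
    by metis
  have tlim: "filterlim t (at_left 1) sequentially"
  proof -
    have "t \<longlonglongrightarrow> 1"
    proof (rule real_tendsto_sandwich[of "\<lambda>n. 1 - 1 / real (Suc n)" _ _ "\<lambda>n. 1"])
      show "(\<lambda>n. 1 - 1 / real (Suc n)) \<longlonglongrightarrow> 1" by real_asymp
      show "\<forall>\<^sub>F n in sequentially. 1 - 1 / real (Suc n) \<le> t n"
        using t(2) by (intro always_eventually allI) (smt (verit))
      show "\<forall>\<^sub>F n in sequentially. t n \<le> 1"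
        using t(1) by (intro always_eventually allI) (simp add: less_imp_le)
    qed auto
    moreover have "t n \<in> {..<1} \<and> t n \<noteq> 1" for n
      using t(1)[of n] by auto
    ultimately show ?thesis
      by (simp add: filterlim_at)
  qed
  obtain q r where q: "strict_mono (r :: nat \<Rightarrow> nat)" "(\<lambda>n. \<gamma> (t (r n))) \<longlonglongrightarrow> q"
  proof -
    have "bounded (range (\<gamma> \<circ> t))"
      using t(3) by (auto simp: bounded_iff intro!: exI[of _ M] less_imp_le)
    then show thesis
      using bounded_imp_convergent_subsequence[of "\<gamma> \<circ> t"] that by (auto simp: o_def)
  qed
  have trlim: "filterlim (\<lambda>n. t (r n)) (at_left 1) sequentially"
    using filterlim_compose[OF tlim filterlim_subseq[OF q(1)]] .
  have fq: "(\<lambda>n. f (\<gamma> (t (r n)))) \<longlonglongrightarrow> v"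
    using filterlim_compose[OF lim trlim] .
  have qnp: "\<not> is_pole f q"
  proof
    assume pole: "is_pole f q"
    have "filterlim (\<lambda>n. \<gamma> (t (r n))) (at q) sequentially"
      using q(2) np[OF t(1)] pole by (auto simp: filterlim_at intro!: always_eventually)
    then have "filterlim (\<lambda>n. f (\<gamma> (t (r n)))) at_infinity sequentially"
      using pole filterlim_compose unfolding is_pole_def by blast
    with fq show False
      using not_tendsto_and_filterlim_at_infinity sequentially_bot by blast
  qed
  have "f q = v"
    using isCont_tendsto_compose[OF nicely_meromorphic_isCont[OF f qnp] q(2)] fq LIMSEQ_unique by blast
  moreover have dq: "deriv f q \<noteq> 0"
    using v qnp \<open>f q = v\<close> unfolding singular_values_def critical_values_def by blast
  moreover have "(\<gamma> \<longlongrightarrow> q) (at_left 1)"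
  proof -
    obtain e where e: "e > 0" "inj_on f (ball q e)" "\<And>x. x \<in> ball q e \<Longrightarrow> \<not> is_pole f x"
      using local_inverse[OF f qnp dq] by metis
    show ?thesis
      unfolding tendsto_iff
    proof (intro allI impI)
      fix d :: real assume "d > 0"
      \<comment> \<open>The closed disc of radius \<open>k\<close> about \<open>q\<close> lies where
        \<open>f\<close> is injective, so on the circle bounding it \<open>f\<close> keeps a
        positive distance from \<open>v = f q\<close>.\<close>
      define k where "k = min (d/2) (e/2)"
      have k: "k > 0" "k < e" "k < d" using \<open>d > 0\<close> e(1) by (auto simp: k_def)
      have "continuous_on (sphere q k) (\<lambda>x. norm (f x - v))"
      proof -
        have "f holomorphic_on sphere q k"
          using k by (intro nicely_meromorphic_holomorphic[OF f] e(3)) auto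
        then show ?thesis
          by (intro continuous_intros holomorphic_on_imp_continuous_on)
      qed
      moreover have "sphere q k \<noteq> {}" using k by auto
      ultimately obtain x0 where x0: "x0 \<in> sphere q k" "\<And>x. x \<in> sphere q k \<Longrightarrow> norm (f x0 - v) \<le> norm (f x - v)"
        using continuous_attains_inf[of "sphere q k" "\<lambda>x. norm (f x - v)"] compact_sphere by metis
      have "f x0 \<noteq> v"
      proof
        assume "f x0 = v"
        then have "x0 = q"
          using inj_onD[OF e(2), of x0 q] x0(1) k e(1) \<open>f q = v\<close> by auto
        with x0 k show False by auto
      qed
      then have "eventually (\<lambda>t. dist (f (\<gamma> t)) v < norm (f x0 - v)) (at_left 1)"
        using lim unfolding tendsto_iff by (auto simp: dist_norm)
      then obtain b where b: "b < 1" "\<And>t. b < t \<Longrightarrow> t < 1 \<Longrightarrow> dist (f (\<gamma> t)) v < norm (f x0 - v)"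
        by (auto simp: eventually_at_left_field)
      \<comment> \<open>Times late enough for \<open>f (\<gamma> t)\<close> to be closer to
        \<open>v\<close> than any value of \<open>f\<close> on the circle; the 0 keeps them in the
        domain of \<open>\<gamma>\<close>.\<close>
      define I where "I = {max b 0<..<1}"
      have nosph: "\<gamma> t \<notin> sphere q k" if "t \<in> I" for t
      proof
        assume "\<gamma> t \<in> sphere q k"
        then have "norm (f x0 - v) \<le> norm (f (\<gamma> t) - v)" by (rule x0(2))
        moreover have "dist (f (\<gamma> t)) v < norm (f x0 - v)"
          using b(2) that by (simp add: I_def)
        ultimately show False by (simp add: dist_norm)
      qed
      have "eventually (\<lambda>n. dist (\<gamma> (t (r n))) q < k) sequentially"
        using q(2) k unfolding tendsto_iff by blast
      moreover have "eventually (\<lambda>n. t (r n) \<in> I) sequentially"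
      proof -
        have "eventually (\<lambda>s. s \<in> I) (at_left 1)"
          unfolding eventually_at_left_field using b(1) by (intro exI[of _ "max b 0"]) (simp add: I_def)
        then show ?thesis using trlim unfolding filterlim_iff by blast
      qed
      ultimately have "eventually (\<lambda>n. dist (\<gamma> (t (r n))) q < k \<and> t (r n) \<in> I) sequentially"
        by eventually_elim auto
      from eventually_happens'[OF sequentially_bot this]
      obtain s where s: "dist (\<gamma> s) q < k" "s \<in> I"
        by blast
      \<comment> \<open>The piece of the curve over \<open>I\<close> is connected, is inside the
        disc at time \<open>s\<close> and misses the circle, so it stays inside.\<close>
      have conn: "connected (\<gamma> ` I)"
        by (intro connected_continuous_image continuous_on_subset[OF cont]) (auto simp: I_def)
      have "\<gamma> ` I \<subseteq> ball q k"
      proof (rule ccontr)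
        assume "\<not> \<gamma> ` I \<subseteq> ball q k"
        then have "\<gamma> ` I \<inter> frontier (ball q k) \<noteq> {}"
        proof (intro connected_Int_frontier[OF conn])
          have "\<gamma> s \<in> \<gamma> ` I \<inter> ball q k"
            using s by (simp add: dist_commute)
          then show "\<gamma> ` I \<inter> ball q k \<noteq> {}" by blast
        qed auto
        then show False
          using nosph k(1) unfolding frontier_ball[OF k(1)] by blast
      qed
      then have "dist (\<gamma> t) q < d" if "t \<in> I" for t
      proof -
        have "\<gamma> t \<in> ball q k" using that \<open>\<gamma> ` I \<subseteq> ball q k\<close> by blast
        then show ?thesis using k by (simp add: dist_commute)
      qed
      then show "eventually (\<lambda>t. dist (\<gamma> t) q < d) (at_left 1)"
        unfolding eventually_at_left_field using b(1)
        by (intro exI[of _ "max b 0"]) (simp add: I_def)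
    qed
  qed
  ultimately show thesis using that qnp by blast
qed

section \<open>Lifts over discs and over the plane\<close>

lemma regular_point:
  assumes "\<not> is_pole f q" "f q \<notin> singular_values f"
  shows "deriv f q \<noteq> 0"
  using assms unfolding singular_values_def critical_values_def by blast

text \<open>The lift is a local inverse of \<open>f\<close> at \<open>q\<close> composed with
  \<open>h\<close>. The last clause serves to identify other lifts with values near \<open>q\<close>
  with this one.\<close>

lemma local_lift:
  assumes f: "f nicely_meromorphic_on UNIV"
    and A: "open A" "x0 \<in> A" and h: "h holomorphic_on A"
    and q: "\<not> is_pole f q" "f q = h x0" "deriv f q \<noteq> 0"
  obtains e d g where "e > 0" "d > 0" "ball x0 d \<subseteq> A" "g holomorphic_on ball x0 d"
    "\<And>x. x \<in> ball x0 d \<Longrightarrow> g x \<in> ball q e \<and> \<not> is_pole f (g x) \<and> f (g x) = h x"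
    "\<And>x y. \<lbrakk>x \<in> ball x0 d; y \<in> ball q e; f y = h x\<rbrakk> \<Longrightarrow> y = g x"
proof -
  obtain e k where e: "e > 0" "inj_on f (ball q e)" "\<And>x. x \<in> ball q e \<Longrightarrow> \<not> is_pole f x"
    "open (f ` ball q e)" "k holomorphic_on f ` ball q e"
    "\<And>x. x \<in> ball q e \<Longrightarrow> k (f x) = x"
    using local_inverse[OF f q(1,3)] by blast
  have "open (A \<inter> h -` (f ` ball q e))"
    using continuous_open_preimage[OF holomorphic_on_imp_continuous_on[OF h] A(1) e(4)] .
  moreover have "x0 \<in> A \<inter> h -` (f ` ball q e)"
    using A(2) q(2) e(1) by (metis IntI centre_in_ball image_eqI vimageI)
  ultimately obtain d where d: "d > 0" "ball x0 d \<subseteq> A \<inter> h -` (f ` ball q e)"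
    by (meson openE)
  have "k \<circ> h holomorphic_on ball x0 d"
    by (rule holomorphic_on_compose_gen[OF holomorphic_on_subset[OF h] e(5)]) (use d in auto)
  moreover have "(k \<circ> h) x \<in> ball q e \<and> \<not> is_pole f ((k \<circ> h) x) \<and> f ((k \<circ> h) x) = h x"
    if "x \<in> ball x0 d" for x
  proof -
    have "h x \<in> f ` ball q e" using that d(2) by blast
    then obtain y where "y \<in> ball q e" "h x = f y" by blast
    then show ?thesis using e(3,6) by (simp del: mem_ball)
  qed
  moreover have "y = (k \<circ> h) x" if "x \<in> ball x0 d" "y \<in> ball q e" "f y = h x" for x y
    using that(3) e(6)[OF that(2)] by simp
  ultimately show thesis
    using that[of e d "k \<circ> h"] e(1) d by blast
qed

text \<open>\<open>H\<close> is a branch of the inverse of \<open>f\<close> applied to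
  \<open>h\<close>, normalised at 0. As poles are excluded, \<open>f (H x) = h x\<close> is an
  equation about true values of \<open>f\<close> and never about the dummy value.\<close>

definition lift_on :: "(complex \<Rightarrow> complex) \<Rightarrow> (complex \<Rightarrow> complex) \<Rightarrow> complex \<Rightarrow> complex set \<Rightarrow> (complex \<Rightarrow> complex) \<Rightarrow> bool" where
  "lift_on f h a D H \<longleftrightarrow> H holomorphic_on D \<and> H 0 = a \<and> (\<forall>x\<in>D. \<not> is_pole f (H x) \<and> f (H x) = h x)"

lemma lift_on_unique:
  assumes f: "f nicely_meromorphic_on UNIV"
    and D: "open D" "connected D" "0 \<in> D" "x \<in> D"
    and av: "h 0 \<notin> singular_values f"
    and L: "lift_on f h a D H" "lift_on f h a D H'"
  shows "H x = H' x"
proof (rule unique_lift[OF f D(1,2,3), of H H'])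
  show "\<not> is_pole f (H 0)" "deriv f (H 0) \<noteq> 0"
    using L D(3) av regular_point[of f "H 0"] unfolding lift_on_def by metis+
qed (use L D in \<open>auto simp: lift_on_def\<close>)

lemma lift_on_subset: "lift_on f h a D H \<Longrightarrow> D' \<subseteq> D \<Longrightarrow> lift_on f h a D' H"
  unfolding lift_on_def using holomorphic_on_subset by blast

text \<open>Along the radius to \<open>x0\<close> the values of \<open>f\<close> at \<open>H\<close>
  converge to \<open>h x0\<close>, which is not singular; so \<open>H\<close> has a limit
  \<open>q\<close> there by \<open>path_lift_converges\<close>. The local lift through
  \<open>q\<close> agrees with \<open>H\<close> at a point late on the radius, hence on the whole
  intersection of the two discs.\<close>

lemma lift_extends_at_boundary_point:
  assumes f: "f nicely_meromorphic_on UNIV"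
    and h: "h holomorphic_on ball 0 R"
    and av: "\<And>x. x \<in> ball 0 R \<Longrightarrow> h x \<notin> singular_values f"
    and r: "0 < r" "r < R" and L: "lift_on f h a (ball 0 r) H"
    and x0: "norm x0 = r"
  obtains d g where "d > 0" "ball x0 d \<subseteq> ball 0 R" "g holomorphic_on ball x0 d"
    "\<And>x. x \<in> ball x0 d \<Longrightarrow> \<not> is_pole f (g x) \<and> f (g x) = h x"
    "\<And>x. \<lbrakk>x \<in> ball x0 d; x \<in> ball 0 r\<rbrakk> \<Longrightarrow> g x = H x"
proof -
  have x0R: "x0 \<in> ball 0 R" using x0 r by simp
  define \<gamma> where "\<gamma> t = H (of_real t * x0)" for t :: real
  have inb: "of_real t * x0 \<in> ball 0 r" if "t \<in> {0..<1}" for t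
    using that r(1) x0 by (simp add: norm_mult)
  have holH: "H holomorphic_on ball 0 r" using L by (simp add: lift_on_def)
  have cont: "continuous_on {0..<1} \<gamma>"
    unfolding \<gamma>_def
    by (rule continuous_on_compose2[OF holomorphic_on_imp_continuous_on[OF holH]])
      (use inb in \<open>auto intro!: continuous_intros simp del: mem_ball\<close>)
  have np: "\<not> is_pole f (\<gamma> t)" if "t \<in> {0..<1}" for t
    using L inb[OF that] by (simp add: lift_on_def \<gamma>_def del: mem_ball)
  have lim0: "((\<lambda>t. of_real t * x0) \<longlongrightarrow> x0) (at_left 1)"
    by (auto intro!: tendsto_eq_intros)
  have ev01: "eventually (\<lambda>t::real. t \<in> {0..<1}) (at_left 1)"
    unfolding eventually_at_left_field by (rule exI[of _ 0]) auto
  have "isCont h x0"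
    using h x0R by (meson continuous_on_eq_continuous_at holomorphic_on_imp_continuous_on open_ball)
  then have "((\<lambda>t. h (of_real t * x0)) \<longlongrightarrow> h x0) (at_left 1)"
    using isCont_tendsto_compose lim0 by blast
  then have lim: "((\<lambda>t. f (\<gamma> t)) \<longlongrightarrow> h x0) (at_left 1)"
  proof (rule Lim_transform_eventually)
    show "\<forall>\<^sub>F t in at_left 1. h (of_real t * x0) = f (\<gamma> t)"
      using ev01 by eventually_elim (use L inb in \<open>simp add: lift_on_def \<gamma>_def del: mem_ball\<close>)
  qed
  obtain q where q: "\<not> is_pole f q" "f q = h x0" "deriv f q \<noteq> 0" "(\<gamma> \<longlongrightarrow> q) (at_left 1)"
    using path_lift_converges[OF f cont np lim av[OF x0R]] by blast
  obtain e d g where g: "e > 0" "d > 0" "ball x0 d \<subseteq> ball 0 R" "g holomorphic_on ball x0 d"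
    "\<And>x. x \<in> ball x0 d \<Longrightarrow> g x \<in> ball q e \<and> \<not> is_pole f (g x) \<and> f (g x) = h x"
    "\<And>x y. \<lbrakk>x \<in> ball x0 d; y \<in> ball q e; f y = h x\<rbrakk> \<Longrightarrow> y = g x"
    using local_lift[OF f open_ball x0R h q(1,2,3)] by blast
  have "eventually (\<lambda>t. of_real t * x0 \<in> ball x0 d) (at_left 1)"
    using lim0 g(2) by (simp add: tendsto_iff dist_commute)
  moreover have "eventually (\<lambda>t. \<gamma> t \<in> ball q e) (at_left 1)"
    using q(4) g(1) by (simp add: tendsto_iff dist_commute)
  ultimately have "eventually (\<lambda>t. t \<in> {0..<1} \<and> of_real t * x0 \<in> ball x0 d \<and> \<gamma> t \<in> ball q e) (at_left 1)"
    using ev01 by eventually_elim blast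
  from eventually_happens'[OF trivial_limit_at_left_real this]
  obtain t where t: "t \<in> {0..<1}" "of_real t * x0 \<in> ball x0 d" "\<gamma> t \<in> ball q e" by blast
  have "g x = H x" if "x \<in> ball x0 d" "x \<in> ball 0 r" for x
  proof (rule unique_lift[OF f, of "ball x0 d \<inter> ball 0 r" "of_real t * x0" g H])
    let ?y = "of_real t * x0"
    show "open (ball x0 d \<inter> ball 0 r)" "connected (ball x0 d \<inter> ball 0 r)"
      by (auto intro!: convex_connected convex_Int)
    show "?y \<in> ball x0 d \<inter> ball 0 r" using inb t by blast
    show "g holomorphic_on ball x0 d \<inter> ball 0 r" "H holomorphic_on ball x0 d \<inter> ball 0 r"
      using g(4) holH holomorphic_on_subset by blast+
    show "f (g x) = f (H x)" if "x \<in> ball x0 d \<inter> ball 0 r" for x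
      using that g(5) L by (simp add: lift_on_def)
    show "g ?y = H ?y"
      using g(6)[OF t(2,3)] L inb[OF t(1)] unfolding \<gamma>_def lift_on_def by simp
    show "\<not> is_pole f (g ?y)" using g(5) t(2) by blast
    then show "deriv f (g ?y) \<noteq> 0"
      using regular_point[of f "g ?y"] g(3,5) t(2) av by (metis subsetD)
    show "x \<in> ball x0 d \<inter> ball 0 r" using that by blast
  qed
  with g that show thesis by blast
qed

text \<open>Two balls of equal radius that are centred on a circle and meet have a common point inside the
  circle, namely the midpoint of their centres; so the local extensions fit together.\<close>

lemma midpoint_in_ball:
  fixes x y :: complex
  assumes "norm x = r" "norm y = r" "x \<noteq> y" "z \<in> ball x e" "z \<in> ball y e"
  shows "midpoint x y \<in> ball x e \<inter> ball y e \<inter> ball 0 r"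
proof -
  have "dist x y < 2 * e"
    using assms(4,5) dist_triangle2[of x y z] by (simp add: dist_commute)
  moreover have "dist x (midpoint x y) = dist x y / 2" "dist y (midpoint x y) = dist x y / 2"
    by (simp_all add: dist_midpoint)
  moreover have "norm (midpoint x y) < r"
  proof -
    have sq: "(norm (midpoint x y))\<^sup>2 + (norm (x - y) / 2)\<^sup>2 = ((norm x)\<^sup>2 + (norm y)\<^sup>2) / 2"
      unfolding midpoint_def by (simp add: power2_norm_eq_inner inner_add_left inner_add_right
          inner_diff_left inner_diff_right inner_commute power_mult_distrib power_divide field_simps)
    have "norm (x - y) > 0" using assms(3) by simp
    have "(norm (midpoint x y))\<^sup>2 < r\<^sup>2"
    proof -
      have "0 < (norm (x - y) / 2)\<^sup>2" using \<open>norm (x - y) > 0\<close> by simp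
      moreover have "(norm (midpoint x y))\<^sup>2 + (norm (x - y) / 2)\<^sup>2 = r\<^sup>2"
        using sq assms(1,2) by simp
      ultimately show ?thesis by linarith
    qed
    then show ?thesis using power2_less_imp_less assms(1) norm_ge_zero by blast
  qed
  ultimately show ?thesis by simp
qed

text \<open>By compactness of the circle, the local extensions can all be taken on discs of one
  radius \<open>e\<close>. Equal radii are what the midpoint argument needs to glue them to each
  other.\<close>

lemma lift_extends:
  assumes f: "f nicely_meromorphic_on UNIV"
    and h: "h holomorphic_on ball 0 R"
    and av: "\<And>x. x \<in> ball 0 R \<Longrightarrow> h x \<notin> singular_values f"
    and r: "0 < r" "r < R" and L: "lift_on f h a (ball 0 r) H"
  shows "\<exists>r'>r. \<exists>H'. lift_on f h a (ball 0 r') H'"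
proof -
  define Q where "Q x d g \<longleftrightarrow> d > 0 \<and> ball x d \<subseteq> ball 0 R \<and> g holomorphic_on ball x d \<and>
    (\<forall>y \<in> ball x d. \<not> is_pole f (g y) \<and> f (g y) = h y) \<and>
    (\<forall>y. y \<in> ball x d \<longrightarrow> y \<in> ball 0 r \<longrightarrow> g y = H y)" for x d g
  have "\<exists>d g. Q x d g" if "x \<in> sphere 0 r" for x
  proof -
    have "norm x = r" using that by simp
    from lift_extends_at_boundary_point[OF f h av r L this] show ?thesis
      unfolding Q_def by metis
  qed
  then obtain d where "\<And>x. x \<in> sphere 0 r \<Longrightarrow> \<exists>g. Q x (d x) g" by metis
  then obtain g where "\<And>x. x \<in> sphere 0 r \<Longrightarrow> Q x (d x) (g x)" by metis
  then have dg: "\<And>x. x \<in> sphere 0 r \<Longrightarrow> d x > 0"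
    "\<And>x. x \<in> sphere 0 r \<Longrightarrow> ball x (d x) \<subseteq> ball 0 R"
    "\<And>x. x \<in> sphere 0 r \<Longrightarrow> g x holomorphic_on ball x (d x)"
    "\<And>x y. x \<in> sphere 0 r \<Longrightarrow> y \<in> ball x (d x) \<Longrightarrow> \<not> is_pole f (g x y) \<and> f (g x y) = h y"
    "\<And>x y. x \<in> sphere 0 r \<Longrightarrow> y \<in> ball x (d x) \<Longrightarrow> y \<in> ball 0 r \<Longrightarrow> g x y = H y"
    unfolding Q_def by blast+
  have "sphere 0 r \<subseteq> \<Union>((\<lambda>x. ball x (d x)) ` sphere 0 r)"
    using dg(1) by (force simp del: mem_sphere)
  \<comment> \<open>\<open>e\<close> is a Lebesgue number of the cover by the discs of the local
    extensions.\<close>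
  from Heine_Borel_lemma[OF compact_sphere this]
  obtain e where e: "e > 0" "\<And>x. x \<in> sphere 0 r \<Longrightarrow> \<exists>G\<in>(\<lambda>x. ball x (d x)) ` sphere 0 r. ball x e \<subseteq> G"
    by auto
  then have "\<forall>x\<in>sphere 0 r. \<exists>c\<in>sphere 0 r. ball x e \<subseteq> ball c (d c)" by blast
  then obtain c where c: "\<And>x. x \<in> sphere 0 r \<Longrightarrow> c x \<in> sphere 0 r \<and> ball x e \<subseteq> ball (c x) (d (c x))"
    by metis
  \<comment> \<open>The disc of radius \<open>e\<close> about \<open>x\<close> inherits the
    extension from a disc containing it, whose centre \<open>c x\<close> may differ from
    \<open>x\<close>.\<close>
  define k where "k x = g (c x)" for x
  have k: "k x holomorphic_on ball x e"
    "\<And>y. y \<in> ball x e \<Longrightarrow> \<not> is_pole f (k x y) \<and> f (k x y) = h y \<and> y \<in> ball 0 R"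
    "\<And>y. y \<in> ball x e \<Longrightarrow> y \<in> ball 0 r \<Longrightarrow> k x y = H y" if x: "x \<in> sphere 0 r" for x
    using dg(2-5)[of "c x"] c[OF x] holomorphic_on_subset unfolding k_def by blast+
  have agree: "k x z = k y z" if xy: "x \<in> sphere 0 r" "y \<in> sphere 0 r" "z \<in> ball x e" "z \<in> ball y e" for x y z
  proof (cases "x = y")
    case False
    let ?D = "ball x e \<inter> ball y e" and ?m = "midpoint x y"
    \<comment> \<open>The midpoint lies in the original disc, where both extensions equal
      \<open>H\<close>.\<close>
    have m: "?m \<in> ball x e" "?m \<in> ball y e" "?m \<in> ball 0 r"
      using midpoint_in_ball[of x r y z e] xy False by auto
    show ?thesis
    proof (rule unique_lift[OF f, of ?D ?m "k x" "k y"])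
      show "open ?D" "connected ?D" by (auto intro!: convex_connected convex_Int)
      show "k x holomorphic_on ?D" "k y holomorphic_on ?D"
        using k(1) xy(1,2) holomorphic_on_subset by blast+
      show "f (k x u) = f (k y u)" if "u \<in> ?D" for u
        using that k(2)[OF xy(1)] k(2)[OF xy(2)] by simp
      show "k x ?m = k y ?m" using k(3)[OF xy(1)] k(3)[OF xy(2)] m by simp
      show "\<not> is_pole f (k x ?m)" using k(2)[OF xy(1) m(1)] by blast
      then show "deriv f (k x ?m) \<noteq> 0"
        using regular_point[of f "k x ?m"] k(2)[OF xy(1) m(1)] av by metis
    qed (use m xy in blast)+
  qed simp
  \<comment> \<open>The index \<open>None\<close> stands for the original disc,
    \<open>Some x\<close> for the disc about \<open>x\<close>.\<close>
  define D where "D i = (case i of None \<Rightarrow> ball 0 r | Some x \<Rightarrow> ball x e)" for i :: "complex option"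
  define K where "K i = (case i of None \<Rightarrow> H | Some x \<Rightarrow> k x)" for i
  define I where "I = insert None (Some ` sphere (0::complex) r)"
  have LH: "H holomorphic_on ball 0 r" "H 0 = a" "\<And>x. x \<in> ball 0 r \<Longrightarrow> \<not> is_pole f (H x) \<and> f (H x) = h x"
    using L by (auto simp: lift_on_def)
  obtain H' where H': "H' holomorphic_on (\<Union>i\<in>I. D i)" "\<And>i x. \<lbrakk>i \<in> I; x \<in> D i\<rbrakk> \<Longrightarrow> H' x = K i x"
  proof (rule holomorphic_glue[of I D K])
    show "open (D i)" for i by (simp add: D_def split: option.split)
    show "K i holomorphic_on D i" if "i \<in> I" for i
      using that LH(1) k(1) by (auto simp: I_def D_def K_def)
    show "K i x = K j x" if "i \<in> I" "j \<in> I" "x \<in> D i" "x \<in> D j" for i j x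
    proof (cases i; cases j)
      fix a b assume "i = Some a" "j = Some b"
      then show ?thesis using that agree[of a b x] by (auto simp: I_def D_def K_def simp del: mem_ball mem_sphere)
    next
      fix a assume "i = Some a" "j = None"
      then show ?thesis using that k(3)[of a x] by (auto simp: I_def D_def K_def simp del: mem_ball mem_sphere)
    next
      fix b assume "i = None" "j = Some b"
      then show ?thesis using that k(3)[of b x] by (auto simp: I_def D_def K_def simp del: mem_ball mem_sphere)
    qed simp
  qed blast
  have sub: "ball 0 (r + e) \<subseteq> (\<Union>i\<in>I. D i)"
  proof
    fix x :: complex assume x: "x \<in> ball 0 (r + e)"
    show "x \<in> (\<Union>i\<in>I. D i)"
    proof (cases "norm x < r")
      case True
      then have "x \<in> D None" by (simp add: D_def)
      then show ?thesis by (auto simp: I_def)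
    next
      case False
      \<comment> \<open>The radial projection of \<open>x\<close> to the circle.\<close>
      define y where "y = of_real (r / norm x) * x"
      have nx: "norm x > 0" using False r(1) by linarith
      have "norm y = r" using r(1) nx by (simp add: y_def norm_mult norm_divide)
      moreover have "norm (y - x) < e"
      proof -
        have "y - x = of_real (r / norm x - 1) * x" by (simp add: y_def algebra_simps)
        then have "norm (y - x) = \<bar>r / norm x - 1\<bar> * norm x"
          by (simp only: norm_mult norm_of_real)
        also have "\<dots> = norm x - r" using False nx by (simp add: abs_if field_simps)
        finally show ?thesis using x by simp
      qed
      ultimately have "Some y \<in> I" "x \<in> D (Some y)"
        by (auto simp: I_def D_def dist_norm)
      then show ?thesis by blast
    qed
  qed
  have "lift_on f h a (ball 0 (r + e)) H'"
    unfolding lift_on_def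
  proof (intro conjI ballI)
    show "H' holomorphic_on ball 0 (r + e)" using H'(1) sub holomorphic_on_subset by blast
    show "H' 0 = a" using H'(2)[of None 0] LH(2) r(1) by (simp add: I_def D_def K_def)
    fix x :: complex assume "x \<in> ball 0 (r + e)"
    then obtain i where i: "i \<in> I" "x \<in> D i" using sub by blast
    have "\<not> is_pole f (K i x) \<and> f (K i x) = h x"
      using i LH(3) k(2) unfolding I_def D_def K_def by (auto simp del: mem_ball mem_sphere)
    then show "\<not> is_pole f (H' x)" "f (H' x) = h x" using H'(2)[OF i] by simp_all
  qed
  then show ?thesis using e(1) by (intro exI[of _ "r + e"]) auto
qed

text \<open>By uniqueness, lifts on concentric discs agree where both are defined, and can be glued.
  This serves both to attain the supremum of the possible radii and to exhaust the plane.\<close>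

lemma lift_Union:
  assumes f: "f nicely_meromorphic_on UNIV"
    and h0: "h 0 \<notin> singular_values f"
    and "\<And>r. r \<in> S \<Longrightarrow> r > 0 \<and> (\<exists>H. lift_on f h a (ball 0 r) H)" and "S \<noteq> {}"
  shows "\<exists>H. lift_on f h a (\<Union>r\<in>S. ball 0 r) H"
proof -
  obtain G where G: "\<And>r. r \<in> S \<Longrightarrow> r > 0" "\<And>r. r \<in> S \<Longrightarrow> lift_on f h a (ball 0 r) (G r)"
    using assms(3) by metis
  obtain H where H: "H holomorphic_on (\<Union>r\<in>S. ball 0 r)" "\<And>r x. \<lbrakk>r \<in> S; x \<in> ball 0 r\<rbrakk> \<Longrightarrow> H x = G r x"
  proof (rule holomorphic_glue[of S "ball 0" G])
    show "G i holomorphic_on ball 0 i" if "i \<in> S" for i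
      using G(2)[OF that] by (simp add: lift_on_def)
    show "G i x = G j x" if "i \<in> S" "j \<in> S" "x \<in> ball 0 i" "x \<in> ball 0 j" for i j x
    proof (rule lift_on_unique[OF f, of "ball 0 (min i j)" x h a])
      show "lift_on f h a (ball 0 (min i j)) (G i)" "lift_on f h a (ball 0 (min i j)) (G j)"
        using G(2) that(1,2) lift_on_subset subset_ball by (metis min.cobounded1 min.cobounded2)+
      show "h 0 \<notin> singular_values f" by (rule h0)
    qed (use that G(1) in auto)
  qed (auto simp del: mem_ball)
  have "lift_on f h a (\<Union>r\<in>S. ball 0 r) H"
    unfolding lift_on_def
  proof (intro conjI ballI)
    obtain r where r: "r \<in> S" using assms(4) by blast
    then show "H 0 = a" using H(2)[OF r, of 0] G[OF r] by (simp add: lift_on_def)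
    fix x :: complex assume "x \<in> (\<Union>r\<in>S. ball 0 r)"
    then obtain r where "r \<in> S" "x \<in> ball 0 r" by blast
    then show "\<not> is_pole f (H x)" "f (H x) = h x"
      using H(2) G(2) by (auto simp: lift_on_def)
  qed (rule H(1))
  then show ?thesis by blast
qed

text \<open>A continuity argument: the supremum \<open>s\<close> of the radii that admit a lift is
  attained by gluing, and \<open>s < R\<close> would contradict \<open>lift_extends\<close>.\<close>

lemma lift_exists_ball:
  assumes f: "f nicely_meromorphic_on UNIV"
    and h: "h holomorphic_on ball 0 R" and R: "R > 0"
    and av: "\<And>x. x \<in> ball 0 R \<Longrightarrow> h x \<notin> singular_values f"
    and a: "\<not> is_pole f a" "f a = h 0"
  shows "\<exists>H. lift_on f h a (ball 0 R) H"
proof -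
  have h0: "h 0 \<notin> singular_values f" using av R by simp
  define S where "S = {r. 0 < r \<and> r \<le> R \<and> (\<exists>H. lift_on f h a (ball 0 r) H)}"
  have "S \<noteq> {}"
  proof -
    have 0: "0 \<in> ball 0 R" using R by simp
    have da: "deriv f a \<noteq> 0" using regular_point[OF a(1)] a(2) h0 by simp
    have "\<exists>d g. d > 0 \<and> g holomorphic_on ball 0 d \<and>
      (\<forall>x\<in>ball 0 d. \<not> is_pole f (g x) \<and> f (g x) = h x) \<and> g 0 = a"
    proof (rule local_lift[OF f open_ball 0 h a da])
      fix e d :: real and g
      assume *: "e > 0" "d > 0" "g holomorphic_on ball 0 d"
        "\<And>x. x \<in> ball 0 d \<Longrightarrow> g x \<in> ball a e \<and> \<not> is_pole f (g x) \<and> f (g x) = h x"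
        "\<And>x y. \<lbrakk>x \<in> ball 0 d; y \<in> ball a e; f y = h x\<rbrakk> \<Longrightarrow> y = g x"
      have "a = g 0" by (rule *(5)) (use *(1,2) a(2) in simp_all)
      then show ?thesis using *(2-4) by (intro exI[of _ d] exI[of _ g]) blast
    qed
    then obtain d g where g: "d > 0" "g holomorphic_on ball 0 d"
      "\<And>x. x \<in> ball 0 d \<Longrightarrow> \<not> is_pole f (g x) \<and> f (g x) = h x" "g 0 = a"
      by blast
    have "lift_on f h a (ball 0 (min d R)) g"
      unfolding lift_on_def using g(3,4) holomorphic_on_subset[OF g(2), of "ball 0 (min d R)"]
      by (simp add: subset_ball)
    then have "min d R \<in> S" using R g(1) by (auto simp: S_def)
    then show ?thesis by blast
  qed
  define s where "s = Sup S"
  have bdd: "bdd_above S" unfolding S_def by (rule bdd_aboveI[of _ R]) auto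
  obtain r0 where r0: "r0 \<in> S" using \<open>S \<noteq> {}\<close> by blast
  have s0: "s > 0" using cSup_upper[OF r0 bdd] r0 by (auto simp: S_def s_def)
  have sR: "s \<le> R" unfolding s_def by (rule cSup_least[OF \<open>S \<noteq> {}\<close>]) (auto simp: S_def)
  have un: "(\<Union>r\<in>S. ball 0 r) = ball (0::complex) s"
  proof (intro equalityI subsetI)
    fix x :: complex assume "x \<in> (\<Union>r\<in>S. ball 0 r)"
    then show "x \<in> ball 0 s" using cSup_upper[OF _ bdd] by (force simp: s_def)
  next
    fix x :: complex assume "x \<in> ball 0 s"
    then show "x \<in> (\<Union>r\<in>S. ball 0 r)"
      using less_cSup_iff[OF \<open>S \<noteq> {}\<close> bdd] by (auto simp: s_def)
  qed
  obtain H where H: "lift_on f h a (ball 0 s) H"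
    using lift_Union[OF f, of h S a] h0 \<open>S \<noteq> {}\<close> unfolding un by (auto simp: S_def)
  have "s = R"
  proof (rule ccontr)
    assume "s \<noteq> R"
    then have "s < R" using sR by simp
    from lift_extends[OF f h av s0 this H] obtain r' H' where r': "r' > s" "lift_on f h a (ball 0 r') H'"
      by blast
    have "lift_on f h a (ball 0 (min r' R)) H'" using lift_on_subset[OF r'(2)] by (simp add: subset_ball)
    then have "min r' R \<in> S" using r'(1) s0 R by (auto simp: S_def)
    then have "min r' R \<le> s" unfolding s_def using bdd by (rule cSup_upper)
    then show False using r'(1) \<open>s < R\<close> by linarith
  qed
  with H show ?thesis by blast
qed

lemma lift_exists_UNIV:
  assumes f: "f nicely_meromorphic_on UNIV"
    and h: "h holomorphic_on UNIV"
    and av: "\<And>x. h x \<notin> singular_values f"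
    and a: "\<not> is_pole f a" "f a = h 0"
  shows "\<exists>H. lift_on f h a UNIV H"
proof -
  have "\<exists>H. lift_on f h a (\<Union>r\<in>{0<..}. ball 0 r) H"
  proof (rule lift_Union[OF f av])
    fix r :: real assume "r \<in> {0<..}"
    then show "r > 0 \<and> (\<exists>H. lift_on f h a (ball 0 r) H)"
      using lift_exists_ball[OF f holomorphic_on_subset[OF h] _ av a] by simp
  qed auto
  moreover have "(\<Union>r\<in>{0<..}. ball 0 r) = (UNIV :: complex set)"
  proof -
    have "x \<in> (\<Union>r\<in>{0<..}. ball 0 r)" for x :: complex
      by (rule UN_I[of "norm x + 1"]) (auto simp: add_nonneg_pos)
    then show ?thesis by blast
  qed
  ultimately show ?thesis by simp
qed

section \<open>Normal families and the Fatou set\<close>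

text \<open>The Schottky-type bound \<open>GPicard3\<close> makes the functions uniformly bounded on
  compact sets, so that Montel's theorem for locally bounded families applies.\<close>

lemma Montel_omit_01_bounded_at:
  fixes \<psi> :: "nat \<Rightarrow> complex \<Rightarrow> complex"
  assumes S: "open S" "connected S" "w \<in> S"
    and hol: "\<And>n. \<psi> n holomorphic_on S"
    and om: "\<And>n z. z \<in> S \<Longrightarrow> \<psi> n z \<noteq> 0 \<and> \<psi> n z \<noteq> 1"
    and le1: "\<And>n. norm (\<psi> n w) \<le> 1"
  obtains g r where "g holomorphic_on S" "strict_mono (r :: nat \<Rightarrow> nat)"
    "\<And>K. \<lbrakk>compact K; K \<subseteq> S\<rbrakk> \<Longrightarrow> uniform_limit K (\<lambda>n. \<psi> (r n)) g sequentially"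
proof -
  have "\<exists>B. \<forall>h\<in>range \<psi>. \<forall>z\<in>K. norm (h z) \<le> B" if K: "compact K" "K \<subseteq> S" for K
  proof -
    obtain B where "\<And>h z. h \<in> range \<psi> \<Longrightarrow> z \<in> K \<Longrightarrow> norm (h z) \<le> B"
      by (rule GPicard3[of S w "range \<psi>" "range \<psi>" K]) (use S hol om le1 K in auto)
    then show ?thesis by blast
  qed
  then obtain g r where "g holomorphic_on S" "strict_mono (r :: nat \<Rightarrow> nat)"
    "\<And>K. \<lbrakk>compact K; K \<subseteq> S\<rbrakk> \<Longrightarrow> uniform_limit K (\<psi> \<circ> r) g sequentially"
    using Montel[of S "range \<psi>" \<psi>] S(1) hol by (metis (no_types, lifting) imageE subset_refl)
  then show thesis using that by (simp add: o_def)
qed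

text \<open>A subsequence has its values at \<open>w\<close> either all in the closed unit disc or
  all outside it. In the second case the reciprocals omit 0 and 1 too and are bounded at
  \<open>w\<close>. By Hurwitz their limit either has no zeros and can be inverted, or vanishes
  identically, which is convergence of the functions themselves to infinity.\<close>

lemma Montel_omit_01:
  fixes \<phi> :: "nat \<Rightarrow> complex \<Rightarrow> complex"
  assumes S: "open S" "connected S" "w \<in> S"
    and hol: "\<And>n. \<phi> n holomorphic_on S"
    and om: "\<And>n z. z \<in> S \<Longrightarrow> \<phi> n z \<noteq> 0 \<and> \<phi> n z \<noteq> 1"
  obtains r where "strict_mono (r :: nat \<Rightarrow> nat)"
    "(\<exists>g. g holomorphic_on S \<and> (\<forall>K. compact K \<and> K \<subseteq> S \<longrightarrow> uniform_limit K (\<lambda>n. \<phi> (r n)) g sequentially)) \<or>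
     (\<forall>K. compact K \<and> K \<subseteq> S \<longrightarrow> uniform_limit K (\<lambda>n z. inverse (\<phi> (r n) z)) (\<lambda>z. 0) sequentially)"
proof (cases "infinite {n. norm (\<phi> n w) \<le> 1}")
  case True
  then obtain r0 where r0: "strict_mono (r0 :: nat \<Rightarrow> nat)" "\<And>n. norm (\<phi> (r0 n) w) \<le> 1"
    using infinite_enumerate by blast
  obtain g r where "g holomorphic_on S" "strict_mono (r :: nat \<Rightarrow> nat)"
    "\<And>K. \<lbrakk>compact K; K \<subseteq> S\<rbrakk> \<Longrightarrow> uniform_limit K (\<lambda>n. \<phi> (r0 (r n))) g sequentially"
    using Montel_omit_01_bounded_at[OF S, of "\<lambda>n. \<phi> (r0 n)"] hol om r0(2) by blast
  then show thesis using that[of "r0 \<circ> r"] strict_mono_o[OF r0(1)] by auto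
next
  case False
  have "{n. \<not> norm (\<phi> n w) \<le> 1} = UNIV - {n. norm (\<phi> n w) \<le> 1}" by auto
  then have "infinite {n. \<not> norm (\<phi> n w) \<le> 1}"
    using False Diff_infinite_finite infinite_UNIV_nat by metis
  then obtain r0 where r0: "strict_mono (r0 :: nat \<Rightarrow> nat)" "\<And>n. \<not> norm (\<phi> (r0 n) w) \<le> 1"
    using infinite_enumerate by blast
  define \<psi> where "\<psi> n z = inverse (\<phi> (r0 n) z)" for n z
  have \<psi>hol: "\<psi> n holomorphic_on S" for n
    unfolding \<psi>_def using hol om by (intro holomorphic_on_inverse) auto
  have \<psi>om: "\<psi> n z \<noteq> 0 \<and> \<psi> n z \<noteq> 1" if "z \<in> S" for n z
    using om[OF that] by (simp add: \<psi>_def)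
  have "norm (\<psi> n w) \<le> 1" for n
    using r0(2)[of n] by (simp add: \<psi>_def norm_inverse inverse_le_1_iff)
  then obtain G r where G: "G holomorphic_on S" "strict_mono (r :: nat \<Rightarrow> nat)"
    "\<And>K. \<lbrakk>compact K; K \<subseteq> S\<rbrakk> \<Longrightarrow> uniform_limit K (\<lambda>n. \<psi> (r n)) G sequentially"
    using Montel_omit_01_bounded_at[OF S, of \<psi>] \<psi>hol \<psi>om by metis
  have sm: "strict_mono (r0 \<circ> r)" using r0(1) G(2) by (rule strict_mono_o)
  show thesis
  proof (cases "\<forall>z\<in>S. G z \<noteq> 0")
    case True
    have "uniform_limit K (\<lambda>n. \<phi> ((r0 \<circ> r) n)) (inverse \<circ> G) sequentially" if K: "compact K" "K \<subseteq> S" for K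
    proof (cases "K = {}")
      case False
      \<comment> \<open>Inverting a uniform limit requires a positive lower bound; on
        \<open>K\<close> it is the minimum of \<open>norm (G z)\<close>.\<close>
      have "continuous_on K (\<lambda>z. norm (G z))"
        using G(1) K holomorphic_on_imp_continuous_on continuous_on_norm continuous_on_subset by blast
      from continuous_attains_inf[OF K(1) False this]
      obtain z0 where z0: "z0 \<in> K" "\<And>z. z \<in> K \<Longrightarrow> norm (G z0) \<le> norm (G z)" by blast
      have "uniform_limit K (\<lambda>n z. inverse (\<psi> (r n) z)) (inverse \<circ> G) sequentially"
        using z0 True K by (intro uniform_lim_inverse[OF G(3)[OF K], of "norm (G z0)"]) auto
      then show ?thesis by (simp add: \<psi>_def)
    qed simp
    moreover have "(inverse \<circ> G) holomorphic_on S"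
      using G(1) True by (auto simp: o_def intro!: holomorphic_intros)
    ultimately show ?thesis using that[OF sm] by blast
  next
    case False
    then obtain z0 where z0: "z0 \<in> S" "G z0 = 0" by blast
    have "G constant_on S"
    proof (rule ccontr)
      assume "\<not> G constant_on S"
      then have "G z0 \<noteq> 0"
        using \<psi>om z0(1) by (intro Hurwitz_no_zeros[OF S(1,2), of "\<lambda>n. \<psi> (r n)" G] \<psi>hol G) auto
      with z0 show False by simp
    qed
    then have G0: "G z = 0" if "z \<in> S" for z using z0 that unfolding constant_on_def by auto
    have "uniform_limit K (\<lambda>n z. inverse (\<phi> ((r0 \<circ> r) n) z)) (\<lambda>z. 0) sequentially" if K: "compact K" "K \<subseteq> S" for K
    proof -
      have "uniform_limit K (\<lambda>n z. inverse (\<phi> ((r0 \<circ> r) n) z)) G sequentially"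
        using G(3)[OF K] by (simp add: \<psi>_def[abs_def])
      then show ?thesis
        using G0 K(2) by (subst uniform_limit_cong'[where i = G]) auto
    qed
    then show ?thesis using that[OF sm] by blast
  qed
qed

section \<open>Convergence in the spherical metric\<close>

lemma stereo_at_infinity: "((\<lambda>z. stereo (Some z)) \<longlongrightarrow> stereo None) at_infinity"
proof -
  have "((\<lambda>z. 2 / ((cmod z)\<^sup>2 + 1) * cmod z) \<longlongrightarrow> 0) at_infinity"
    by (rule filterlim_compose[OF _ filterlim_norm_at_top]) real_asymp
  then have "((\<lambda>z. norm ((2 / ((cmod z)\<^sup>2 + 1)) *\<^sub>R z)) \<longlongrightarrow> 0) at_infinity"
    by (simp add: abs_of_nonneg)
  then have "((\<lambda>z. (2 / ((cmod z)\<^sup>2 + 1)) *\<^sub>R z) \<longlongrightarrow> 0) at_infinity"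
    using tendsto_norm_zero_iff by blast
  moreover have "((\<lambda>z. ((cmod z)\<^sup>2 - 1) / ((cmod z)\<^sup>2 + 1)) \<longlongrightarrow> 1) at_infinity"
    by (rule filterlim_compose[OF _ filterlim_norm_at_top]) real_asymp
  ultimately show ?thesis
    unfolding stereo_def by (auto intro!: tendsto_Pair)
qed

text \<open>The limit is bounded on the compact set \<open>K\<close>, so eventually all values lie
  in one closed disc, on which the projection is uniformly continuous.\<close>

lemma uniform_limit_stereo:
  fixes s :: "nat \<Rightarrow> complex \<Rightarrow> complex"
  assumes u: "uniform_limit K s g sequentially" and K: "compact K" "continuous_on K g"
  shows "uniform_limit K (\<lambda>n z. stereo (Some (s n z))) (\<lambda>z. stereo (Some (g z))) sequentially"
proof -
  have "bounded (g ` K)" using K compact_continuous_image compact_imp_bounded by blast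
  then obtain B where B: "\<And>z. z \<in> K \<Longrightarrow> norm (g z) \<le> B" by (auto simp: bounded_iff)
  show ?thesis
  proof (rule uniform_limit_compose_uniformly_continuous_on[OF u])
    show "uniformly_continuous_on (cball 0 (B + 1)) (\<lambda>z. stereo (Some z))"
      using continuous_on_stereo_Some continuous_on_subset by (intro compact_uniformly_continuous) auto
    have "eventually (\<lambda>n. \<forall>z\<in>K. dist (s n z) (g z) < 1) sequentially"
      using u unfolding uniform_limit_iff by simp
    then show "\<forall>\<^sub>F n in sequentially. \<forall>z\<in>K. s n z \<in> cball 0 (B + 1)"
    proof (eventually_elim, intro ballI)
      fix n z assume *: "\<forall>z\<in>K. dist (s n z) (g z) < 1" "z \<in> K"
      have "norm (s n z) \<le> norm (g z) + dist (s n z) (g z)"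
        by (simp add: dist_norm norm_triangle_sub)
      then show "s n z \<in> cball 0 (B + 1)" using B[OF *(2)] *(1)[rule_format, OF *(2)] by simp
    qed
  qed simp
qed

text \<open>An affine map takes \<open>a\<close> and \<open>b\<close> to 0 and 1 and reduces this to
  \<open>Montel_omit_01\<close>. If the reciprocals there tend to 0, the spherical limit is
  constantly \<open>None\<close>.\<close>

lemma Montel_spherical:
  fixes s :: "nat \<Rightarrow> complex \<Rightarrow> complex"
  assumes S: "open S" "connected S" "w \<in> S" and ab: "a \<noteq> b"
    and hol: "\<And>n. s n holomorphic_on S"
    and om: "\<And>n z. z \<in> S \<Longrightarrow> s n z \<noteq> a \<and> s n z \<noteq> b"
  obtains r G where "strict_mono (r :: nat \<Rightarrow> nat)"
    "\<And>K. \<lbrakk>compact K; K \<subseteq> S\<rbrakk> \<Longrightarrow>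
       uniform_limit K (\<lambda>n z. stereo (Some (s (r n) z))) (\<lambda>z. stereo (G z)) sequentially"
proof -
  define \<phi> where "\<phi> n z = (s n z - a) / (b - a)" for n z
  have s_eq: "s n z = a + (b - a) * \<phi> n z" for n z
    using ab by (simp add: \<phi>_def)
  obtain r where r: "strict_mono (r :: nat \<Rightarrow> nat)"
    "(\<exists>g. g holomorphic_on S \<and> (\<forall>K. compact K \<and> K \<subseteq> S \<longrightarrow> uniform_limit K (\<lambda>n. \<phi> (r n)) g sequentially)) \<or>
     (\<forall>K. compact K \<and> K \<subseteq> S \<longrightarrow> uniform_limit K (\<lambda>n z. inverse (\<phi> (r n) z)) (\<lambda>z. 0) sequentially)"
  proof (rule Montel_omit_01[OF S, of \<phi>])
    show "\<phi> n holomorphic_on S" for n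
      unfolding \<phi>_def using ab hol by (auto intro!: holomorphic_intros)
    show "\<phi> n z \<noteq> 0 \<and> \<phi> n z \<noteq> 1" if "z \<in> S" for n z
      using om[OF that, of n] ab by (auto simp: \<phi>_def)
  qed blast
  from r(2) show thesis
  proof
    assume "\<exists>g. g holomorphic_on S \<and> (\<forall>K. compact K \<and> K \<subseteq> S \<longrightarrow> uniform_limit K (\<lambda>n. \<phi> (r n)) g sequentially)"
    then obtain g where g: "g holomorphic_on S"
      "\<And>K. \<lbrakk>compact K; K \<subseteq> S\<rbrakk> \<Longrightarrow> uniform_limit K (\<lambda>n. \<phi> (r n)) g sequentially" by blast
    show thesis
    proof (rule that[OF r(1), of "\<lambda>z. Some (a + (b - a) * g z)"])
      fix K assume K: "compact K" "K \<subseteq> S"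
      have "continuous_on K g" using g(1) K(2) holomorphic_on_imp_continuous_on holomorphic_on_subset by blast
      then have c: "continuous_on K (\<lambda>z. a + (b - a) * g z)" by (intro continuous_intros)
      have "uniform_limit K (\<lambda>n z. s (r n) z) (\<lambda>z. a + (b - a) * g z) sequentially"
        unfolding s_eq
        by (intro uniform_limit_add uniform_limit_const bounded_linear.uniform_limit[OF bounded_linear_mult_right] g(2) K)
      from uniform_limit_stereo[OF this K(1) c]
      show "uniform_limit K (\<lambda>n z. stereo (Some (s (r n) z))) (\<lambda>z. stereo (Some (a + (b - a) * g z))) sequentially" .
    qed
  next
    assume inf: "\<forall>K. compact K \<and> K \<subseteq> S \<longrightarrow> uniform_limit K (\<lambda>n z. inverse (\<phi> (r n) z)) (\<lambda>z. 0) sequentially"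
    show thesis
    proof (rule that[OF r(1), of "\<lambda>z. None"])
      fix K assume K: "compact K" "K \<subseteq> S"
      show "uniform_limit K (\<lambda>n z. stereo (Some (s (r n) z))) (\<lambda>z. stereo None) sequentially"
      proof (rule uniform_limitI)
        fix e :: real assume "e > 0"
        then have "eventually (\<lambda>u. dist (stereo (Some u)) (stereo None) < e) at_infinity"
          using stereo_at_infinity by (simp add: tendsto_iff)
        then obtain M where M: "\<And>u. norm u \<ge> M \<Longrightarrow> dist (stereo (Some u)) (stereo None) < e"
          by (auto simp: eventually_at_infinity)
        \<comment> \<open>Chosen so that \<open>norm (inverse (\<phi> (r n) z)) < d\<close> forces
          \<open>norm (s (r n) z - a)\<close> above \<open>\<bar>M\<bar> + norm a + 1\<close>, and
          hence \<open>norm (s (r n) z)\<close> above \<open>M\<close>.\<close>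
        define d where "d = norm (b - a) / (\<bar>M\<bar> + norm a + 1)"
        have nab: "norm (b - a) > 0" using ab by simp
        have Mp: "\<bar>M\<bar> + norm a + 1 > 0" using norm_ge_zero[of a] by linarith
        have d: "d > 0" unfolding d_def using nab Mp by (rule divide_pos_pos)
        have "eventually (\<lambda>n. \<forall>z\<in>K. dist (inverse (\<phi> (r n) z)) 0 < d) sequentially"
          using inf K d unfolding uniform_limit_iff by blast
        then show "\<forall>\<^sub>F n in sequentially. \<forall>z\<in>K. dist (stereo (Some (s (r n) z))) (stereo None) < e"
        proof (eventually_elim, intro ballI)
          fix n z assume *: "\<forall>z\<in>K. dist (inverse (\<phi> (r n) z)) 0 < d" "z \<in> K"
          have sa: "norm (s (r n) z - a) > 0" using om K(2) *(2) by auto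
          have "norm (b - a) / norm (s (r n) z - a) < d"
            using *(1)[rule_format, OF *(2)] by (simp add: \<phi>_def norm_divide)
          then have "\<bar>M\<bar> + norm a + 1 < norm (s (r n) z - a)"
            unfolding d_def using nab Mp sa by (simp add: divide_less_cancel divide_simps)
          also have "\<dots> \<le> norm (s (r n) z) + norm a" by (rule norm_triangle_ineq4)
          finally show "dist (stereo (Some (s (r n) z))) (stereo None) < e" by (intro M) linarith
        qed
      qed
    qed
  qed
qed

section \<open>Iterates, postsingular points and the Fatou set\<close>

lemma iter_add: "iter f (m + n) z = Option.bind (iter f m z) (iter f n)"
  by (induction n) (cases "iter f m z"; simp)+

lemma iter_Suc_left: "iter f (Suc n) z = Option.bind (sphere_map f z) (iter f n)"
  using iter_add[of f 1 n z] by simp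

lemma iter_Suc_nonpole: "\<not> is_pole f z \<Longrightarrow> iter f (Suc n) z = iter f n (f z)"
  by (simp only: iter_Suc_left) (simp add: sphere_map_def)

text \<open>Used mostly in the contrapositive: an orbit that reaches a point outside the
  postsingular set has never been in it.\<close>

lemma postsingular_iter:
  assumes "w \<in> postsingular_set f" "iter f n w = Some u"
  shows "u \<in> postsingular_set f"
proof -
  obtain s m where s: "s \<in> closure (singular_values f)" "iter f m s = Some w"
    using assms(1) by (auto simp: postsingular_set_def)
  have "iter f (m + n) s = Some u" using s(2) assms(2) by (simp add: iter_add)
  with s(1) show ?thesis unfolding postsingular_set_def by blast
qed

lemma singular_subset_postsingular: "singular_values f \<subseteq> postsingular_set f"
proof
  fix s assume "s \<in> singular_values f"
  then have "s \<in> closure (singular_values f)" using closure_subset by blast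
  moreover have "iter f 0 s = Some s" by simp
  ultimately show "s \<in> postsingular_set f" unfolding postsingular_set_def by blast
qed

lemma holomorphic_iter:
  assumes f: "f nicely_meromorphic_on UNIV" and fin: "\<And>w. w \<in> V \<Longrightarrow> iter f n w \<noteq> None"
  shows "(\<lambda>w. the (iter f n w)) holomorphic_on V"
  using fin
proof (induction n)
  case (Suc n)
  have fin: "iter f n w \<noteq> None \<and> \<not> is_pole f (the (iter f n w)) \<and> iter f (Suc n) w = Some (f (the (iter f n w)))"
    if "w \<in> V" for w
    using Suc.prems[OF that] by (cases "iter f n w") (auto simp: sphere_map_def split: if_splits)
  have IH: "(\<lambda>w. the (iter f n w)) holomorphic_on V" using fin by (intro Suc.IH) blast
  have "f holomorphic_on ((\<lambda>w. the (iter f n w)) ` V)"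
    using fin by (intro nicely_meromorphic_holomorphic[OF f]) blast
  from holomorphic_on_compose[OF IH this]
  have "(\<lambda>w. f (the (iter f n w))) holomorphic_on V" by (simp add: o_def)
  then show ?case using fin by (subst holomorphic_cong[OF refl]) auto
qed simp

text \<open>As the iterates are finite on \<open>V\<close>, they are holomorphic there, and
  \<open>Montel_spherical\<close> gives normality.\<close>

lemma fatou_setI_omit:
  assumes f: "f nicely_meromorphic_on UNIV" and V: "open V" "z \<in> V" and ab: "a \<noteq> b"
    and om: "\<And>w n. w \<in> V \<Longrightarrow> iter f n w \<noteq> None \<and> iter f n w \<noteq> Some a \<and> iter f n w \<noteq> Some b"
  shows "z \<in> fatou_set f"
proof -
  \<comment> \<open>Montel's theorem is applied on a disc, since it asks for a connected
    domain.\<close>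
  obtain d where d: "d > 0" "ball z d \<subseteq> V" using V openE by blast
  have "normal_family_on (ball z d) {iter f n |n. n > 0}"
    unfolding normal_family_on_def
  proof (intro allI impI)
    fix s :: "nat \<Rightarrow> complex \<Rightarrow> complex option" assume "range s \<subseteq> {iter f n |n. n > 0}"
    then have "\<forall>i. \<exists>n. s i = iter f n" by blast
    then obtain m where m: "\<And>i. s i = iter f (m i)" by metis
    define \<psi> where "\<psi> i w = the (iter f (m i) w)" for i w
    have eq: "iter f (m i) w = Some (\<psi> i w)" if "w \<in> ball z d" for i w
      using om that d(2) unfolding \<psi>_def by (metis option.collapse subsetD)
    obtain r G where rG: "strict_mono (r :: nat \<Rightarrow> nat)"
      "\<And>K. \<lbrakk>compact K; K \<subseteq> ball z d\<rbrakk> \<Longrightarrow>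
         uniform_limit K (\<lambda>n w. stereo (Some (\<psi> (r n) w))) (\<lambda>w. stereo (G w)) sequentially"
    proof (rule Montel_spherical[of "ball z d" z a b \<psi>])
      show "\<psi> n holomorphic_on ball z d" for n
        unfolding \<psi>_def using om d(2) by (intro holomorphic_iter[OF f]) blast
      show "\<psi> n w \<noteq> a \<and> \<psi> n w \<noteq> b" if "w \<in> ball z d" for n w
        using eq[OF that, of n] om[of w "m n"] that d(2) by auto
    qed (use d ab in auto)
    show "\<exists>r g. strict_mono r \<and> (\<forall>K. compact K \<and> K \<subseteq> ball z d \<longrightarrow>
              uniform_limit K (\<lambda>n z. stereo (s (r n) z)) (\<lambda>z. stereo (g z)) sequentially)"
    proof (intro exI[of _ r] exI[of _ G] conjI allI impI rG(1))
      fix K assume K: "compact K \<and> K \<subseteq> ball z d"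
      have "uniform_limit K (\<lambda>n z. stereo (s (r n) z)) (\<lambda>z. stereo (G z)) sequentially \<longleftrightarrow>
        uniform_limit K (\<lambda>n w. stereo (Some (\<psi> (r n) w))) (\<lambda>w. stereo (G w)) sequentially"
        using K by (intro uniform_limit_cong') (auto simp: m eq subsetD)
      with rG(2) K show "uniform_limit K (\<lambda>n z. stereo (s (r n) z)) (\<lambda>z. stereo (G z)) sequentially"
        by blast
    qed
  qed
  moreover have "iter_defined f n w" if "w \<in> ball z d" for n w
    using om that d(2) unfolding iter_defined_def by blast
  ultimately show ?thesis
    unfolding fatou_set_def using d(1) by (intro CollectI exI[of _ "ball z d"]) auto
qed

lemma open_fatou_set: "open (fatou_set f)"
proof (rule openI)
  fix z assume "z \<in> fatou_set f"
  then obtain V where V: "open V" "z \<in> V" "\<forall>n>0. \<forall>w\<in>V. iter_defined f n w"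
    "normal_family_on V {iter f n | n. n > 0}"
    unfolding fatou_set_def by blast
  then have "V \<subseteq> fatou_set f" unfolding fatou_set_def by blast
  then show "\<exists>e>0. ball z e \<subseteq> fatou_set f" using V openE by (meson order_trans)
qed

lemma fatou_set_iter_finite:
  assumes "z \<in> fatou_set f" shows "iter f n z \<noteq> None"
proof -
  have "iter_defined f (Suc n) z" using assms unfolding fatou_set_def by blast
  then show ?thesis unfolding iter_defined_def by simp
qed

text \<open>Near \<open>z\<close> the map \<open>f\<close> is injective. With a local inverse
  \<open>k\<close>, the \<open>n\<close>-th iterate near \<open>f z\<close> is the
  \<open>Suc n\<close>-th iterate near \<open>z\<close> composed with \<open>k\<close>, so that
  finiteness and normality carry over.\<close>

lemma fatou_set_step:
  assumes f: "f nicely_meromorphic_on UNIV" and z: "z \<in> fatou_set f" "deriv f z \<noteq> 0"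
  shows "f z \<in> fatou_set f"
proof -
  obtain V where V: "open V" "z \<in> V" "\<forall>n>0. \<forall>w\<in>V. iter_defined f n w"
    "normal_family_on V {iter f n | n. n > 0}"
    using z(1) unfolding fatou_set_def by blast
  have np: "\<not> is_pole f z"
    using fatou_set_iter_finite[OF z(1), of 1] by (auto simp: sphere_map_def)
  obtain e where e: "e > 0" "inj_on f (ball z e)" "\<And>x. x \<in> ball z e \<Longrightarrow> \<not> is_pole f x"
    using local_inverse[OF f np z(2)] by metis
  obtain d0 where d0: "d0 > 0" "cball z d0 \<subseteq> V" using V(1,2) open_contains_cball by blast
  define d where "d = min d0 e"
  have d: "d > 0" "ball z d \<subseteq> ball z e" "cball z d \<subseteq> V"
    using d0 e(1) by (auto simp: d_def)
  have hol: "f holomorphic_on ball z d"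
    using d(2) e(3) by (intro nicely_meromorphic_holomorphic[OF f]) blast
  define V' where "V' = f ` ball z d"
  have oV': "open V'"
    unfolding V'_def by (rule open_mapping_thm3[OF hol open_ball inj_on_subset[OF e(2) d(2)]])
  define k where "k y = (SOME x. x \<in> ball z d \<and> f x = y)" for y
  have k: "k y \<in> ball z d \<and> f (k y) = y" if "y \<in> V'" for y
    unfolding k_def by (rule someI_ex) (use that in \<open>auto simp: V'_def\<close>)
  have it: "iter f n y = iter f (Suc n) (k y)" if "y \<in> V'" for n y
    using iter_Suc_nonpole[of f "k y" n] k[OF that] e(3) d(2) by (metis subsetD)
  have "iter_defined f n y" if y: "y \<in> V'" for n y
  proof -
    have "k y \<in> V" using k[OF y] d(3) ball_subset_cball by blast
    then have "iter_defined f (Suc n) (k y)" using V(3) by blast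
    then show ?thesis using it[OF y] unfolding iter_defined_def by auto
  qed
  moreover have "normal_family_on V' {iter f n | n. n > 0}"
    unfolding normal_family_on_def
  proof (intro allI impI)
    fix s :: "nat \<Rightarrow> complex \<Rightarrow> complex option" assume "range s \<subseteq> {iter f n |n. n > 0}"
    then have "\<forall>i. \<exists>n. s i = iter f n" by blast
    then obtain m where m: "\<And>i. s i = iter f (m i)" by metis
    have "range (\<lambda>i. iter f (Suc (m i))) \<subseteq> {iter f n | n. n > 0}" by blast
    from V(4)[unfolded normal_family_on_def, rule_format, OF this]
    obtain r g where "strict_mono (r :: nat \<Rightarrow> nat) \<and> (\<forall>K. compact K \<and> K \<subseteq> V \<longrightarrow>
      uniform_limit K (\<lambda>n x. stereo (iter f (Suc (m (r n))) x)) (\<lambda>x. stereo (g x)) sequentially)"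
      by (elim exE)
    then have rg: "strict_mono r"
      "\<And>K. compact K \<Longrightarrow> K \<subseteq> V \<Longrightarrow>
        uniform_limit K (\<lambda>n x. stereo (iter f (Suc (m (r n))) x)) (\<lambda>x. stereo (g x)) sequentially"
      by blast+
    have u: "uniform_limit (cball z d) (\<lambda>n x. stereo (iter f (Suc (m (r n))) x)) (\<lambda>x. stereo (g x)) sequentially"
      by (rule rg(2)[OF compact_cball d(3)])
    show "\<exists>r g. strict_mono r \<and> (\<forall>K. compact K \<and> K \<subseteq> V' \<longrightarrow>
              uniform_limit K (\<lambda>n z. stereo (s (r n) z)) (\<lambda>z. stereo (g z)) sequentially)"
    proof (intro exI[of _ r] exI[of _ "g \<circ> k"] conjI allI impI rg(1))
      fix K assume K: "compact K \<and> K \<subseteq> V'"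
      \<comment> \<open>All values of \<open>k\<close> lie in one compact disc, on which the
        convergence is uniform; so it remains uniform after composition with
        \<open>k\<close>.\<close>
      have "k \<in> K \<rightarrow> cball z d" using k K ball_subset_cball by blast
      from uniform_limit_compose'[OF u this]
      have "uniform_limit K (\<lambda>n y. stereo (iter f (Suc (m (r n))) (k y))) (\<lambda>y. stereo (g (k y))) sequentially" .
      moreover have "uniform_limit K (\<lambda>n z. stereo (s (r n) z)) (\<lambda>z. stereo ((g \<circ> k) z)) sequentially \<longleftrightarrow>
        uniform_limit K (\<lambda>n y. stereo (iter f (Suc (m (r n))) (k y))) (\<lambda>y. stereo (g (k y))) sequentially"
        using K it by (intro uniform_limit_cong') (auto simp: m subsetD simp del: iter.simps)
      ultimately show "uniform_limit K (\<lambda>n z. stereo (s (r n) z)) (\<lambda>z. stereo ((g \<circ> k) z)) sequentially"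
        by blast
    qed
  qed
  moreover have "f z \<in> V'" unfolding V'_def using d(1) by simp
  ultimately show ?thesis
    unfolding fatou_set_def using oV' by blast
qed

section \<open>The postsingular set has two points\<close>

text \<open>If \<open>s\<close> were the only finite value, \<open>f\<close> would take only the
  value \<open>s\<close> and the dummy value 0. It would then be bounded, so without poles, and
  hence constant.\<close>

lemma transcendental_not_constant:
  assumes f: "f nicely_meromorphic_on UNIV" and tr: "transcendental f"
  obtains w where "\<not> is_pole f w" "f w \<noteq> s"
proof -
  have "\<exists>w. \<not> is_pole f w \<and> f w \<noteq> s"
  proof (rule ccontr)
    assume *: "\<not> ?thesis"
    have val: "f w = s \<or> f w = 0" for w
    proof (cases "is_pole f w")
      case True
      then have "\<not> f \<midarrow>w\<rightarrow> f w"
        unfolding is_pole_def using not_tendsto_and_filterlim_at_infinity at_neq_bot by blast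
      then show ?thesis using f unfolding nicely_meromorphic_on_def by blast
    qed (use * in blast)
    have np: "\<not> is_pole f p" for p
    proof
      assume "is_pole f p"
      then have "eventually (\<lambda>w. norm s + 1 \<le> norm (f w)) (at p)"
        unfolding is_pole_def filterlim_at_infinity_conv_norm_at_top filterlim_at_top by blast
      moreover have "\<not> norm s + 1 \<le> norm (f w)" for w using val[of w] norm_ge_zero[of s] by (metis add_increasing2 not_less norm_zero less_add_one add.commute le_less_trans)
      ultimately show False by simp
    qed
    then have "f = (\<lambda>w. s)" using * by auto
    then have "not_essential (\<lambda>w. f (1 / w)) 0" unfolding not_essential_def by auto
    with tr show False unfolding transcendental_def by simp
  qed
  then show thesis using that by blast
qed

lemma exp_eq_const_imp_constant:
  assumes \<phi>: "\<phi> holomorphic_on UNIV" and c: "\<And>x. exp (\<phi> x) = c"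
  obtains C where "\<And>x. \<phi> x = C" "exp C = c"
proof -
  have "(\<phi> has_field_derivative 0) (at x)" for x
  proof -
    have d: "(\<phi> has_field_derivative deriv \<phi> x) (at x)"
      using \<phi> holomorphic_derivI open_UNIV by blast
    have "((\<lambda>x. exp (\<phi> x)) has_field_derivative exp (\<phi> x) * deriv \<phi> x) (at x)"
      by (rule DERIV_chain2[OF DERIV_exp d])
    moreover have "((\<lambda>x. exp (\<phi> x)) has_field_derivative 0) (at x)" unfolding c by simp
    ultimately have "exp (\<phi> x) * deriv \<phi> x = 0" by (rule DERIV_unique)
    then show ?thesis using d by simp
  qed
  then obtain C where "\<And>x. \<phi> x = C"
    using has_field_derivative_zero_constant[of UNIV \<phi>] by (metis UNIV_I convex_UNIV)
  then show thesis using that c by metis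
qed

text \<open>The omitted value \<open>s\<close> makes \<open>f (1 / w) - s\<close> nonzero, so that a limit 0 of its reciprocal means a
  pole; at zeros, the reciprocal has the junk value \<open>inverse 0 = 0\<close>.\<close>

lemma transcendental_takes_value_infinitely_often:
  assumes tr: "transcendental f" and hol: "f holomorphic_on - {p}"
    and ne: "\<And>q. q \<noteq> p \<Longrightarrow> f q \<noteq> s"
  obtains v where "v \<noteq> s" "infinite {q. q \<noteq> p \<and> f q = v}"
proof -
  \<comment> \<open>For nonzero \<open>w\<close> in this disc \<open>1 / w\<close> is larger in norm
    than \<open>p\<close>, and so differs from it.\<close>
  define M where "M = ball (0::complex) (1 / (norm p + 1))"
  define F where "F w = f (1 / w) - s" for w
  have np1: "norm p + 1 > 0" by (simp add: add_nonneg_pos)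
  have M: "1 / w \<noteq> p" if "w \<in> M - {0}" for w
  proof
    assume "1 / w = p"
    then have "norm p = 1 / norm w" by (simp add: norm_divide flip: \<open>1 / w = p\<close>)
    moreover have "norm w > 0" "norm w < 1 / (norm p + 1)" using that by (auto simp: M_def)
    ultimately show False using np1 by (simp add: field_simps)
  qed
  have Fhol: "F holomorphic_on M - {0}"
  proof -
    have "(f \<circ> (\<lambda>w. 1 / w)) holomorphic_on M - {0}"
      by (rule holomorphic_on_compose_gen[OF _ hol]) (use M in \<open>auto intro!: holomorphic_intros\<close>)
    then show ?thesis unfolding F_def o_def by (intro holomorphic_intros)
  qed
  have opM: "open M" "0 \<in> M" using np1 by (auto simp: M_def)
  have ess: "\<not> (F \<longlongrightarrow> l) (at 0)" for l
  proof
    assume "(F \<longlongrightarrow> l) (at 0)"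
    then have "((\<lambda>w. F w + s) \<longlongrightarrow> l + s) (at 0)" by (intro tendsto_intros)
    then have "not_essential (\<lambda>w. f (1 / w)) 0" unfolding F_def not_essential_def by auto
    with tr show False by (simp add: transcendental_def)
  qed
  have ess': "\<not> ((inverse \<circ> F) \<longlongrightarrow> l) (at 0)" for l
  proof
    assume l: "((inverse \<circ> F) \<longlongrightarrow> l) (at 0)"
    show False
    proof (cases "l = 0")
      case False
      then have "(F \<longlongrightarrow> inverse l) (at 0)"
        using tendsto_inverse[OF l False] by (simp add: o_def)
      with ess show False by blast
    next
      case True
      have "eventually (\<lambda>w. w \<in> M - {0}) (at 0)"
        using opM eventually_at_in_open by blast
      then have "eventually (\<lambda>w. (inverse \<circ> F) w \<noteq> 0) (at 0)"
        by eventually_elim (use ne M in \<open>auto simp: F_def\<close>)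
      then have "filterlim (\<lambda>w. inverse (F w)) (at 0) (at 0)"
        using l True by (auto simp: filterlim_at o_def)
      then have "filterlim F at_infinity (at 0)" by (simp add: filterlim_inverse_at_iff)
      then have "filterlim (\<lambda>w. s + F w) at_infinity (at 0)"
        by (intro tendsto_add_filterlim_at_infinity[OF tendsto_const])
      then have "is_pole (\<lambda>w. f (1 / w)) 0" by (simp add: is_pole_def F_def)
      with tr show False by (simp add: transcendental_def not_essential_def)
    qed
  qed
  \<comment> \<open>Great Picard: near the essential singularity, \<open>F\<close> takes every value
    except possibly \<open>a\<close> infinitely often.\<close>
  obtain a where a: "\<And>w. w \<noteq> a \<Longrightarrow> infinite {x. x \<in> M - {0} \<and> F x = w}"
    using great_Picard_infinite[OF opM Fhol ess ess'] by blast
  \<comment> \<open>The value 0 of \<open>F\<close> corresponds to the value \<open>s\<close> of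
    \<open>f\<close> and must be avoided too.\<close>
  obtain w where w: "w \<noteq> a" "w \<noteq> 0"
  proof (cases "a = 1")
    case True then show thesis using that[of 2] by simp
  next
    case False then show thesis using that[of 1] by simp
  qed
  have "infinite {q. q \<noteq> p \<and> f q = w + s}"
  proof
    assume fin: "finite {q. q \<noteq> p \<and> f q = w + s}"
    have "inj_on (\<lambda>x. 1 / x) {x. x \<in> M - {0} \<and> F x = w}" by (auto simp: inj_on_def)
    moreover have "(\<lambda>x. 1 / x) ` {x. x \<in> M - {0} \<and> F x = w} \<subseteq> {q. q \<noteq> p \<and> f q = w + s}"
      using M by (auto simp: F_def algebra_simps)
    ultimately show False using a[OF w(1)] inj_on_finite fin by blast
  qed
  then show thesis using that[of "w + s"] w(2) by simp
qed

text \<open>With at most one singular value \<open>s\<close>, the exponential map onto \<open>\<complex> - {s}\<close> lifts through \<open>f\<close> to an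
  entire map \<open>H\<close>, which omits the poles and the \<open>s\<close>-points of \<open>f\<close>; so there is at most one of these, by
  Picard. If there were one, say \<open>p\<close>, then the exponential map onto \<open>\<complex> - {p}\<close> would be, up to a
  translation, the lift of \<open>f\<close> in the other direction, and \<open>f\<close> would be finite-to-one.\<close>

lemma one_singular_value_omitted:
  assumes f: "f nicely_meromorphic_on UNIV" and tr: "transcendental f"
    and sing: "singular_values f \<subseteq> {s}"
  shows "\<not> is_pole f p \<and> f p \<noteq> s"
proof (rule ccontr)
  assume pA: "\<not> (\<not> is_pole f p \<and> f p \<noteq> s)"
  obtain a where a: "\<not> is_pole f a" "f a \<noteq> s"
    using transcendental_not_constant[OF f tr] by blast
  \<comment> \<open>This factor normalises the covering \<open>h\<close> of the plane without
    \<open>s\<close> by \<open>h 0 = f a\<close>.\<close>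
  define c where "c = f a - s"
  have c0: "c \<noteq> 0" using a by (simp add: c_def)
  define h where "h x = s + c * exp x" for x
  have h_ne: "h x \<noteq> s" for x using c0 by (simp add: h_def)
  have h_eq: "h x = h y \<longleftrightarrow> exp x = exp y" for x y using c0 by (simp add: h_def)
  have hol_h: "h holomorphic_on UNIV" unfolding h_def by (intro holomorphic_intros)
  have h0: "f a = h 0" by (simp add: h_def c_def)
  obtain H where "lift_on f h a UNIV H"
    using lift_exists_UNIV[OF f hol_h _ a(1) h0] h_ne sing by blast
  then have H: "H holomorphic_on UNIV" "H 0 = a" "\<And>x. \<not> is_pole f (H x)" "\<And>x. f (H x) = h x"
    by (auto simp: lift_on_def)
  have A: "\<not> is_pole f q \<and> f q \<noteq> s" if "q \<noteq> p" for q
  proof (rule ccontr)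
    assume q: "\<not> (\<not> is_pole f q \<and> f q \<noteq> s)"
    have "H x \<noteq> p" "H x \<noteq> q" for x using pA q H(3,4) h_ne by metis+
    then have "range H \<inter> {p, q} = {}" by blast
    with H(1) that[symmetric] obtain d where "H = (\<lambda>x. d)" by (rule little_Picard)
    then have "h 0 = h (\<i> * of_real pi)" using H(4) by metis
    then show False by (simp add: h_eq)
  qed
  have Hp: "H x \<noteq> p" for x using pA H(3,4) h_ne by metis
  have hol: "f holomorphic_on - {p}"
    using A by (intro nicely_meromorphic_holomorphic[OF f]) blast
  have pe: "p + exp x \<noteq> p" for x by simp
  have "(\<lambda>x. (f (p + exp x) - s) / c) holomorphic_on UNIV"
  proof -
    have "(f \<circ> (\<lambda>x. p + exp x)) holomorphic_on UNIV"
      by (rule holomorphic_on_compose_gen[OF _ hol]) (auto intro!: holomorphic_intros)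
    then show ?thesis unfolding o_def using c0 by (intro holomorphic_intros) auto
  qed
  moreover have "(f (p + exp x) - s) / c \<noteq> 0" for x using A[OF pe] c0 by simp
  \<comment> \<open>\<open>m\<close> lifts \<open>f (p + exp x)\<close> through \<open>h\<close>,
    and \<open>g\<close> below writes \<open>H x\<close> as \<open>p + exp (g x)\<close>. The aim is
    to show that \<open>m\<close> and \<open>g\<close> are inverse to each other up to
    translations.\<close>
  ultimately obtain m where m: "m holomorphic_on UNIV" "\<And>x. exp (m x) = (f (p + exp x) - s) / c"
    using holomorphic_logarithm_exists[of UNIV "\<lambda>x. (f (p + exp x) - s) / c"] by (metis UNIV_I convex_UNIV open_UNIV)
  have fm: "f (p + exp x) = h (m x)" for x using c0 by (simp add: h_def m(2))
  have "(\<lambda>x. H x - p) holomorphic_on UNIV" using H(1) by (intro holomorphic_intros)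
  moreover have "H x - p \<noteq> 0" for x using Hp by simp
  ultimately obtain g where g: "g holomorphic_on UNIV" "\<And>x. exp (g x) = H x - p"
    using holomorphic_logarithm_exists[of UNIV "\<lambda>x. H x - p"] by (metis UNIV_I convex_UNIV open_UNIV)
  have comp: "(\<lambda>x. u (v x)) holomorphic_on UNIV" if "u holomorphic_on UNIV" "v holomorphic_on UNIV" for u v :: "complex \<Rightarrow> complex"
    using holomorphic_on_compose_gen[OF that(2,1)] by (simp add: o_def)
  have e1: "exp (m (g x) - x) = 1" for x
  proof -
    have "h (m (g x)) = h x" using fm[of "g x"] g(2)[of x] H(4)[of x] by simp
    then show ?thesis by (simp add: h_eq exp_diff)
  qed
  have h1: "(\<lambda>x. m (g x) - x) holomorphic_on UNIV"
    by (intro holomorphic_on_diff holomorphic_on_ident comp[OF m(1) g(1)])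
  obtain C where C: "\<And>x. m (g x) - x = C" "exp C = 1"
    using exp_eq_const_imp_constant[OF h1 e1] by blast
  \<comment> \<open>Both sides are mapped by \<open>f\<close> to \<open>f (p + exp y)\<close> and
    have the same value at \<open>y = g 0\<close>.\<close>
  have HC: "H (m y - C) = p + exp y" for y
  proof (rule unique_lift[OF f, of UNIV "g 0" "\<lambda>y. H (m y - C)" "\<lambda>y. p + exp y"])
    show "(\<lambda>y. H (m y - C)) holomorphic_on UNIV"
      by (intro comp[OF H(1)] holomorphic_on_diff holomorphic_on_const m(1))
    show "(\<lambda>y. p + exp y) holomorphic_on UNIV" by (intro holomorphic_intros)
    show "f (H (m x - C)) = f (p + exp x)" for x
      using C(2) by (simp add: H(4) fm h_eq exp_diff)
    have 0: "m (g 0) - C = 0" using C(1)[of 0] by simp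
    show "H (m (g 0) - C) = p + exp (g 0)" unfolding 0 by (simp add: g(2))
    show "\<not> is_pole f (H (m (g 0) - C))" by (rule H(3))
    have "f a \<notin> singular_values f" using a(2) sing by blast
    then show "deriv f (H (m (g 0) - C)) \<noteq> 0" unfolding 0 H(2) by (rule regular_point[OF a(1)])
  qed auto
  have e2: "exp (g (m y - C) - y) = 1" for y using g(2)[of "m y - C"] HC[of y] by (simp add: exp_diff)
  have h2: "(\<lambda>y. g (m y - C) - y) holomorphic_on UNIV"
    by (intro holomorphic_on_diff holomorphic_on_ident holomorphic_on_const comp[OF g(1)] m(1))
  obtain C' where C': "\<And>y. g (m y - C) - y = C'"
    using exp_eq_const_imp_constant[OF h2 e2] by blast
  have inj: "y = y'" if "m y = m y'" for y y'
  proof -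
    have "g (m y - C) - y = g (m y - C) - y'"
      using C'[of y] C'[of y'] that by simp
    then show ?thesis by simp
  qed
  \<comment> \<open>The period of \<open>exp\<close>. As \<open>exp (m y)\<close> has this period,
    \<open>m (y + T) - m y\<close> is a constant multiple \<open>k\<close> of \<open>T\<close>; and
    \<open>k\<close> is nonzero because \<open>m\<close> is injective.\<close>
  define T where "T = 2 * of_real pi * \<i>"
  have expT: "exp (y + of_int l * T) = exp y" for y and l :: int
    using exp_integer_2pi[of "of_int l"] by (simp add: exp_add T_def mult_ac)
  have e3: "exp (m (y + T) - m y) = 1" for y
  proof -
    have "exp (m (y + T)) = exp (m y)" using expT[of y 1] by (simp add: m(2))
    then show ?thesis by (simp add: exp_diff)
  qed
  have h3: "(\<lambda>y. m (y + T) - m y) holomorphic_on UNIV"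
    by (intro holomorphic_on_diff holomorphic_on_add holomorphic_on_ident holomorphic_on_const comp[OF m(1)] m(1))
  obtain D where D: "\<And>y. m (y + T) - m y = D" "exp D = 1"
    using exp_eq_const_imp_constant[OF h3 e3] by blast
  obtain k :: int where k: "D = of_int k * T"
  proof -
    have "exp D = exp 0" using D(2) by simp
    then obtain n :: int where "D = 0 + of_real (real_of_int (2 * n) * pi) * \<i>"
      unfolding exp_eq by blast
    then have "D = of_int n * T" by (simp add: T_def mult_ac)
    then show thesis by (rule that)
  qed
  have "T \<noteq> 0" by (simp add: T_def)
  have "k \<noteq> 0"
  proof
    assume "k = 0"
    then have "m (0 + T) = m 0" using D(1)[of 0] k by simp
    then have "0 + T = 0" by (rule inj)
    with \<open>T \<noteq> 0\<close> show False by simp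
  qed
  have mT: "m (y + of_int l * T) = m y + of_int (l * k) * T" for y and l :: int
  proof (induction l rule: int_induct[where k = 0])
    case (step1 i)
    have "m (y + of_int (i + 1) * T) = m (y + of_int i * T) + D"
      using D(1)[of "y + of_int i * T"] by (simp add: algebra_simps)
    then show ?case using step1.IH by (simp add: k algebra_simps)
  next
    case (step2 i)
    have "m (y + of_int i * T) = m (y + of_int (i - 1) * T) + D"
      using D(1)[of "y + of_int (i - 1) * T"] by (simp add: algebra_simps)
    then show ?case using step2.IH by (simp add: k algebra_simps)
  qed simp
  obtain v where v: "v \<noteq> s" "infinite {q. q \<noteq> p \<and> f q = v}"
    using transcendental_takes_value_infinitely_often[OF tr hol] A by blast
  define Q where "Q = {q. q \<noteq> p \<and> f q = v}"
  have "\<exists>q1. q1 \<in> Q" using v(2) unfolding Q_def by (metis (mono_tags, lifting) equals0I finite.emptyI)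
  then obtain q1 where q1: "q1 \<in> Q" by blast
  have L: "exp (Ln (q - p)) = q - p" if "q \<in> Q" for q using that by (simp add: Q_def)
  have "\<exists>n::int. m (Ln (q - p)) = m (Ln (q1 - p)) + of_int n * T" if "q \<in> Q" for q
  proof -
    have "exp (m (Ln (q - p))) = exp (m (Ln (q1 - p)))"
      using that q1 L[OF that] L[OF q1] by (simp add: m(2) Q_def)
    then obtain n :: int where "m (Ln (q - p)) = m (Ln (q1 - p)) + (of_int (2 * n) * of_real pi) * \<i>"
      unfolding exp_eq by auto
    then show ?thesis by (intro exI[of _ n]) (simp add: T_def algebra_simps)
  qed
  then obtain n :: "complex \<Rightarrow> int"
    where n: "\<And>q. q \<in> Q \<Longrightarrow> m (Ln (q - p)) = m (Ln (q1 - p)) + of_int (n q) * T" by metis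
  \<comment> \<open>If the multipliers of two points agree modulo \<open>k\<close>, then shifting
    one of the logarithms by a multiple of \<open>T\<close> makes the values of \<open>m\<close>
    equal; as \<open>m\<close> is injective, the points coincide. So \<open>f\<close> takes the
    value \<open>v\<close> at most \<open>\<bar>k\<bar>\<close> times.\<close>
  have "inj_on (\<lambda>q. n q mod \<bar>k\<bar>) Q"
  proof (rule inj_onI)
    fix q q' assume q: "q \<in> Q" "q' \<in> Q" "n q mod \<bar>k\<bar> = n q' mod \<bar>k\<bar>"
    then have "k dvd n q - n q'" by (simp add: mod_eq_dvd_iff)
    then obtain l where "n q - n q' = k * l" by (rule dvdE)
    then have l: "n q = n q' + l * k" by (simp add: algebra_simps)
    have "m (Ln (q - p)) = m (Ln (q' - p) + of_int l * T)"
      unfolding mT n[OF q(1)] n[OF q(2)] l by (simp add: algebra_simps)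
    then have "Ln (q - p) = Ln (q' - p) + of_int l * T" by (rule inj)
    then have "exp (Ln (q - p)) = exp (Ln (q' - p))" by (simp add: expT)
    then show "q = q'" using L q(1,2) by simp
  qed
  moreover have "(\<lambda>q. n q mod \<bar>k\<bar>) ` Q \<subseteq> {0..<\<bar>k\<bar>}" using \<open>k \<noteq> 0\<close> by auto
  ultimately have "finite Q" using inj_on_finite finite_atLeastLessThan_int by blast
  with v(2) show False by (simp add: Q_def)
qed

text \<open>Without singular values, \<open>one_singular_value_omitted\<close> could be applied with
  \<open>s = f 0\<close>, and \<open>f\<close> would omit its own value at 0. With a single singular
  value \<open>s\<close>, the point \<open>s\<close> is no pole and \<open>f\<close> omits
  \<open>s\<close>, so that \<open>f s\<close> is a second postsingular point.\<close>

lemma postsingular_set_two_points: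
  assumes f: "f nicely_meromorphic_on UNIV" and tr: "transcendental f"
  obtains a b where "a \<in> postsingular_set f" "b \<in> postsingular_set f" "a \<noteq> b"
proof (rule ccontr)
  assume "\<not> thesis"
  then have one: "a = b" if "a \<in> postsingular_set f" "b \<in> postsingular_set f" for a b
    using that \<open>\<And>b a. \<lbrakk>a \<in> postsingular_set f; b \<in> postsingular_set f; a \<noteq> b\<rbrakk> \<Longrightarrow> thesis\<close> by blast
  show False
  proof (cases "singular_values f = {}")
    case True
    then show False using one_singular_value_omitted[OF f tr, of "f 0" 0] by simp
  next
    case False
    then obtain s where s: "s \<in> singular_values f" by blast
    then have sP: "s \<in> postsingular_set f" using singular_subset_postsingular by blast
    have "singular_values f \<subseteq> {s}"
      using one sP singular_subset_postsingular by blast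
    then have om: "\<not> is_pole f s \<and> f s \<noteq> s" by (rule one_singular_value_omitted[OF f tr])
    then have "iter f 1 s = Some (f s)" by (simp add: sphere_map_def)
    then have "f s \<in> postsingular_set f" by (rule postsingular_iter[OF sP])
    with one sP om show False by blast
  qed
qed

section \<open>Pulling back discs that avoid the postsingular set\<close>

text \<open>The factors of the iterate are inverted one at a time, the one applied last coming
  first. By forward invariance of the postsingular set, the lifted disc avoids it again, so the
  process continues. The lifts meet only regular points, where \<open>fatou_set_step\<close>
  controls the Fatou set.\<close>

lemma pullback_of_iterate:
  assumes f: "f nicely_meromorphic_on UNIV"
    and h: "h holomorphic_on ball 0 1" "\<And>x. x \<in> ball 0 1 \<Longrightarrow> h x \<notin> postsingular_set f"
    and z: "iter f n z = Some (h 0)"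
  shows "\<exists>H. H holomorphic_on ball 0 1 \<and> H 0 = z \<and>
    (\<forall>x\<in>ball 0 1. iter f n (H x) = Some (h x) \<and> H x \<notin> postsingular_set f \<and>
       (H x \<in> fatou_set f \<longrightarrow> h x \<in> fatou_set f))"
  using h z
proof (induction n arbitrary: h)
  case 0
  then show ?case by (intro exI[of _ h]) auto
next
  case (Suc n)
  obtain u where u: "iter f n z = Some u" "\<not> is_pole f u" "f u = h 0"
    using Suc.prems(3) by (cases "iter f n z") (auto simp: sphere_map_def split: if_splits)
  have sing: "h x \<notin> singular_values f" if "x \<in> ball 0 1" for x
    using Suc.prems(2)[OF that] singular_subset_postsingular by blast
  obtain H1 where "lift_on f h u (ball 0 1) H1"
    using lift_exists_ball[OF f Suc.prems(1) zero_less_one sing u(2,3)] by blast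
  then have H1: "H1 holomorphic_on ball 0 1" "H1 0 = u"
    "\<And>x. x \<in> ball 0 1 \<Longrightarrow> \<not> is_pole f (H1 x)" "\<And>x. x \<in> ball 0 1 \<Longrightarrow> f (H1 x) = h x"
    by (simp_all add: lift_on_def del: mem_ball)
  have "H1 x \<notin> postsingular_set f" if x: "x \<in> ball 0 1" for x
  proof
    assume "H1 x \<in> postsingular_set f"
    moreover have "iter f 1 (H1 x) = Some (h x)" using H1(3,4)[OF x] by (simp add: sphere_map_def)
    ultimately have "h x \<in> postsingular_set f" by (rule postsingular_iter)
    with Suc.prems(2)[OF x] show False by blast
  qed
  moreover have "iter f n z = Some (H1 0)" using u(1) H1(2) by simp
  ultimately obtain H where H: "H holomorphic_on ball 0 1" "H 0 = z"
    "\<And>x. x \<in> ball 0 1 \<Longrightarrow> iter f n (H x) = Some (H1 x) \<and> H x \<notin> postsingular_set f \<and>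
       (H x \<in> fatou_set f \<longrightarrow> H1 x \<in> fatou_set f)"
    using Suc.IH[OF H1(1)] by blast
  have "iter f (Suc n) (H x) = Some (h x) \<and> (H x \<in> fatou_set f \<longrightarrow> h x \<in> fatou_set f)"
    if x: "x \<in> ball 0 1" for x
  proof
    show "iter f (Suc n) (H x) = Some (h x)"
      using H(3)[OF x] H1(3,4)[OF x] by (simp add: sphere_map_def)
    have "deriv f (H1 x) \<noteq> 0" using regular_point[of f "H1 x"] H1(3,4)[OF x] sing[OF x] by simp
    then show "H x \<in> fatou_set f \<longrightarrow> h x \<in> fatou_set f"
      using fatou_set_step[OF f, of "H1 x"] H(3)[OF x] H1(4)[OF x] by auto
  qed
  with H show ?case by blast
qed

lemma uniform_limit_at_convergent_points:
  fixes g :: "'a :: metric_space \<Rightarrow> 'b :: metric_space"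
  assumes ul: "uniform_limit K f g sequentially" and g: "continuous_on K g"
    and x: "l \<in> K" "x \<longlonglongrightarrow> l" "\<And>n. x n \<in> K"
  shows "(\<lambda>n. f n (x n)) \<longlonglongrightarrow> g l"
proof (rule tendstoI)
  fix e :: real assume "e > 0"
  then have "eventually (\<lambda>n. \<forall>y\<in>K. dist (f n y) (g y) < e / 2) sequentially"
    using ul unfolding uniform_limit_iff by (meson half_gt_zero)
  moreover have "(\<lambda>n. g (x n)) \<longlonglongrightarrow> g l"
    using continuous_on_tendsto_compose[OF g x(2,1)] x(3) by simp
  then have "eventually (\<lambda>n. dist (g (x n)) (g l) < e / 2) sequentially"
    using \<open>e > 0\<close> by (intro tendstoD) auto
  ultimately show "eventually (\<lambda>n. dist (f n (x n)) (g l) < e) sequentially"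
    by eventually_elim (use x(3) dist_triangle_half_l[of _ _ e] in \<open>auto intro: dist_triangle_half_r simp: dist_commute\<close>)
qed

text \<open>The number \<open>\<theta>\<close> is fixed, while \<open>R\<close> and \<open>y\<close>
  vary with \<open>n\<close>. After rescaling to the unit disc, the points \<open>y\<close> outside
  the Fatou set stay in \<open>cball 0 \<theta>\<close>, so that they accumulate inside the domain
  of the limit \<open>G\<close>.\<close>

lemma no_large_pullbacks:
  assumes f: "f nicely_meromorphic_on UNIV" and tr: "transcendental f" and z: "z \<in> fatou_set f"
    and w: "\<And>n. iter f n z = Some (w n)" and \<theta>: "\<theta> < 1"
  shows "eventually (\<lambda>n. \<not> (\<exists>R y. R > 0 \<and> ball (w n) R \<inter> postsingular_set f = {} \<and>
      dist (w n) y \<le> \<theta> * R \<and> y \<notin> fatou_set f)) sequentially"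
proof (rule ccontr)
  define B where "B n \<longleftrightarrow> (\<exists>R y. R > 0 \<and> ball (w n) R \<inter> postsingular_set f = {} \<and>
      dist (w n) y \<le> \<theta> * R \<and> y \<notin> fatou_set f)" for n
  assume "\<not> ?thesis"
  then have "\<exists>\<^sub>F n in sequentially. B n" unfolding B_def[symmetric] by (simp add: not_eventually)
  then have "infinite {n. B n}" by (simp add: frequently_cofinite[symmetric] cofinite_eq_sequentially)
  then obtain s where s: "strict_mono (s :: nat \<Rightarrow> nat)" "\<And>i. B (s i)"
    using infinite_enumerate by blast
  from s(2) obtain R where "\<And>i. \<exists>y. R i > 0 \<and> ball (w (s i)) (R i) \<inter> postsingular_set f = {} \<and>
      dist (w (s i)) y \<le> \<theta> * R i \<and> y \<notin> fatou_set f"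
    unfolding B_def by metis
  then obtain y where Ry: "\<And>i. R i > 0" "\<And>i. ball (w (s i)) (R i) \<inter> postsingular_set f = {}"
      "\<And>i. dist (w (s i)) (y i) \<le> \<theta> * R i" "\<And>i. y i \<notin> fatou_set f"
    by metis
  define h where "h i x = w (s i) + of_real (R i) * x" for i x
  have hP: "h i x \<notin> postsingular_set f" if "x \<in> ball 0 1" for i x
  proof -
    have "h i x \<in> ball (w (s i)) (R i)"
      using that Ry(1)[of i] by (simp add: h_def dist_norm norm_mult)
    then show ?thesis using Ry(2) by blast
  qed
  have "\<exists>H. H holomorphic_on ball 0 1 \<and> H 0 = z \<and>
    (\<forall>x\<in>ball 0 1. iter f (s i) (H x) = Some (h i x) \<and> H x \<notin> postsingular_set f \<and>
       (H x \<in> fatou_set f \<longrightarrow> h i x \<in> fatou_set f))" for i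
  proof (rule pullback_of_iterate[OF f _ hP])
    show "h i holomorphic_on ball 0 1" unfolding h_def by (intro holomorphic_intros)
    show "iter f (s i) z = Some (h i 0)" by (simp add: w h_def)
  qed
  then obtain H where H: "\<And>i. H i holomorphic_on ball 0 1" "\<And>i. H i 0 = z"
    "\<And>i x. x \<in> ball 0 1 \<Longrightarrow> iter f (s i) (H i x) = Some (h i x)"
    "\<And>i x. x \<in> ball 0 1 \<Longrightarrow> H i x \<notin> postsingular_set f"
    "\<And>i x. x \<in> ball 0 1 \<Longrightarrow> H i x \<in> fatou_set f \<Longrightarrow> h i x \<in> fatou_set f"
    by metis
  obtain a b where ab: "a \<in> postsingular_set f" "b \<in> postsingular_set f" "a \<noteq> b"
    using postsingular_set_two_points[OF f tr] by blast
  have Hab: "H i x \<noteq> a" "H i x \<noteq> b" if "x \<in> ball 0 1" for i x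
    using H(4)[OF that] ab by metis+
  define \<phi> where "\<phi> i x = (H i x - a) / (b - a)" for i x
  have Hphi: "H i x = a + (b - a) * \<phi> i x" for i x using ab by (simp add: \<phi>_def)
  obtain r where r: "strict_mono (r :: nat \<Rightarrow> nat)" and
    alt: "(\<exists>g. g holomorphic_on ball 0 1 \<and> (\<forall>K. compact K \<and> K \<subseteq> ball 0 1 \<longrightarrow> uniform_limit K (\<lambda>n. \<phi> (r n)) g sequentially)) \<or>
     (\<forall>K. compact K \<and> K \<subseteq> ball 0 1 \<longrightarrow> uniform_limit K (\<lambda>n z. inverse (\<phi> (r n) z)) (\<lambda>z. 0) sequentially)"
  proof (rule Montel_omit_01[of "ball 0 1" 0 \<phi>])
    show "\<phi> n holomorphic_on ball 0 1" for n
      unfolding \<phi>_def using ab(3) H(1) by (auto intro!: holomorphic_intros)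
    show "\<phi> n x \<noteq> 0 \<and> \<phi> n x \<noteq> 1" if "x \<in> ball 0 1" for n x
      using Hab[OF that, of n] ab(3) by (simp add: \<phi>_def)
  qed auto
  \<comment> \<open>The limit infinity is impossible, as \<open>H i 0 = z\<close> for all
    \<open>i\<close>.\<close>
  have "\<not> uniform_limit {0} (\<lambda>n z. inverse (\<phi> (r n) z)) (\<lambda>z. 0) sequentially"
  proof
    assume "uniform_limit {0} (\<lambda>n z. inverse (\<phi> (r n) z)) (\<lambda>z. 0) sequentially"
    then have "inverse ((z - a) / (b - a)) = 0" by (simp add: \<phi>_def H(2) LIMSEQ_const_iff)
    then show False using Hab(1)[of 0] H(2) ab(3) by simp
  qed
  moreover have "compact {0::complex} \<and> {0} \<subseteq> ball 0 (1::real)" by simp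
  ultimately obtain g where g: "g holomorphic_on ball 0 1"
    "\<And>K. compact K \<Longrightarrow> K \<subseteq> ball 0 1 \<Longrightarrow> uniform_limit K (\<lambda>n. \<phi> (r n)) g sequentially"
    using alt by blast
  define G where "G x = a + (b - a) * g x" for x
  have holG: "G holomorphic_on ball 0 1" unfolding G_def using g(1) by (intro holomorphic_intros)
  have ulG: "uniform_limit K (\<lambda>n. H (r n)) G sequentially" if K: "compact K" "K \<subseteq> ball 0 1" for K
  proof -
    have "uniform_limit K (\<lambda>n x. a + (b - a) * \<phi> (r n) x) (\<lambda>x. a + (b - a) * g x) sequentially"
      by (intro uniform_limit_add uniform_limit_const bounded_linear.uniform_limit[OF bounded_linear_mult_right] g(2) K)
    then show ?thesis unfolding Hphi[symmetric] G_def[symmetric] .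
  qed
  have G0: "G 0 = z"
  proof -
    have "uniform_limit {0} (\<lambda>n. H (r n)) G sequentially" by (rule ulG) auto
    then show ?thesis by (simp add: H(2) LIMSEQ_const_iff)
  qed
  define x where "x i = (y i - w (s i)) / of_real (R i)" for i
  have xh: "h i (x i) = y i" for i using Ry(1)[of i] by (simp add: x_def h_def)
  have x\<theta>: "x i \<in> cball 0 \<theta>" for i
    using Ry(1)[of i] Ry(3)[of i] by (simp add: x_def norm_divide dist_norm norm_minus_commute field_simps)
  have c1: "cball 0 \<theta> \<subseteq> ball (0::complex) 1" using \<theta> by auto
  obtain x' q where x': "x' \<in> cball 0 \<theta>" and q: "strict_mono (q :: nat \<Rightarrow> nat)" "(\<lambda>n. x (r (q n))) \<longlonglongrightarrow> x'"
  proof -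
    have "seq_compact (cball (0::complex) \<theta>)" using compact_cball compact_imp_seq_compact by blast
    then show thesis
      using seq_compactE[of "cball 0 \<theta>" "\<lambda>n. x (r n)"] x\<theta> that by (auto simp: o_def)
  qed
  \<comment> \<open>The points \<open>y i\<close> pull back to points outside the Fatou set. A
    subsequence of these converges to \<open>G x'\<close>, and the complement of the Fatou set is
    closed.\<close>
  have notF: "G x' \<notin> fatou_set f"
  proof -
    have ul: "uniform_limit (cball 0 \<theta>) (\<lambda>n. H (r (q n))) G sequentially"
      using filterlim_compose[OF ulG[OF compact_cball c1] filterlim_subseq[OF q(1)]] .
    have cG: "continuous_on (cball 0 \<theta>) G"
      using holG c1 holomorphic_on_imp_continuous_on continuous_on_subset by blast
    have lim: "(\<lambda>n. H (r (q n)) (x (r (q n)))) \<longlonglongrightarrow> G x'"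
      using uniform_limit_at_convergent_points[OF ul cG x' q(2)] x\<theta> by blast
    have mem: "H (r (q n)) (x (r (q n))) \<in> - fatou_set f" for n
    proof -
      have "x (r (q n)) \<in> ball 0 1" using x\<theta> c1 by blast
      from H(5)[OF this, of "r (q n)"] show ?thesis using Ry(4)[of "r (q n)"] by (auto simp: xh)
    qed
    have "closed (- fatou_set f)" using open_fatou_set by (simp add: closed_def)
    from closed_sequentially[OF this mem lim] show ?thesis by simp
  qed
  have nc: "\<not> G constant_on ball 0 1"
  proof
    assume "G constant_on ball 0 1"
    then have "G x' = G 0" using x' c1 unfolding constant_on_def by (metis centre_in_ball subsetD zero_less_one)
    with notF G0 z show False by simp
  qed
  have oG: "open (G ` ball 0 1)"
    by (rule open_mapping_thm[OF holG open_ball connected_ball open_ball subset_refl nc])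
  \<comment> \<open>If \<open>v\<close> were missed from the index \<open>N\<close> on, Hurwitz's
    theorem for the shifted sequence would leave \<open>G x - v\<close> without zeros.\<close>
  have hit: "\<exists>n\<ge>N. v \<in> H (r n) ` ball 0 1" if v: "v \<in> G ` ball 0 1" for v N
  proof (rule ccontr)
    assume nhit: "\<not> (\<exists>n\<ge>N. v \<in> H (r n) ` ball 0 1)"
    have nz: "H (r (n + N)) x - v \<noteq> 0" if "x \<in> ball 0 1" for n x
    proof
      assume "H (r (n + N)) x - v = 0"
      then have "v = H (r (n + N)) x" by simp
      then have "v \<in> H (r (n + N)) ` ball 0 1" using that by blast
      with nhit show False using le_add2 by blast
    qed
    obtain x0 where x0: "x0 \<in> ball 0 1" "v = G x0" using v by blast
    have "G x0 - v \<noteq> 0"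
    proof (rule Hurwitz_no_zeros[of "ball 0 1" "\<lambda>n x. H (r (n + N)) x - v" "\<lambda>x. G x - v"])
      show "(\<lambda>x. H (r (n + N)) x - v) holomorphic_on ball 0 1" for n
        using H(1) by (intro holomorphic_intros)
      show "(\<lambda>x. G x - v) holomorphic_on ball 0 1" using holG by (intro holomorphic_intros)
      show "uniform_limit K (\<lambda>n x. H (r (n + N)) x - v) (\<lambda>x. G x - v) sequentially"
        if K: "compact K" "K \<subseteq> ball 0 1" for K
      proof -
        have "uniform_limit K (\<lambda>n. H (r (n + N))) G sequentially"
          using filterlim_compose[OF ulG[OF K] filterlim_add_const_nat_at_top[of N]] .
        then show ?thesis by (intro uniform_limit_minus uniform_limit_const)
      qed
      show "\<not> (\<lambda>x. G x - v) constant_on ball 0 1"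
        using nc unfolding constant_on_def by (metis diff_add_cancel)
    qed (use nz x0 in auto)
    with x0 show False by simp
  qed
  have "G x' \<in> fatou_set f"
  proof (rule fatou_setI_omit[OF f oG _ ab(3)])
    show "G x' \<in> G ` ball 0 1" using x' c1 by blast
    fix v k assume v: "v \<in> G ` ball 0 1"
    \<comment> \<open>With \<open>n \<ge> k\<close> the \<open>k\<close>-th iterate is an earlier
      stage of the \<open>N\<close>-th one. At time \<open>N\<close> the orbit of \<open>v\<close>
      is outside the postsingular set, so it was so at time \<open>k\<close> and missed
      \<open>a\<close> and \<open>b\<close>.\<close>
    obtain n where n: "n \<ge> k" "v \<in> H (r n) ` ball 0 1" using hit[OF v] by blast
    then obtain x0 where x0: "x0 \<in> ball 0 1" "v = H (r n) x0" by blast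
    define N where "N = s (r n)"
    have it: "iter f N v = Some (h (r n) x0)" using H(3)[OF x0(1)] x0(2) by (simp add: N_def)
    have "k \<le> N" unfolding N_def using n(1) seq_suble[OF s(1)] seq_suble[OF r] by (meson order_trans)
    then have it2: "iter f N v = Option.bind (iter f k v) (iter f (N - k))"
      using iter_add[of f k "N - k" v] by simp
    then obtain u where u: "iter f k v = Some u" using it by (cases "iter f k v") auto
    have "u \<notin> postsingular_set f"
      using postsingular_iter[of u f "N - k"] hP[OF x0(1), of "r n"] it it2 u by auto
    with u ab show "iter f k v \<noteq> None \<and> iter f k v \<noteq> Some a \<and> iter f k v \<noteq> Some b" by auto
  qed
  with notF show False by blast
qed

section \<open>Components, their boundaries and distances to them\<close>

lemma frontier_component_disjoint:
  fixes F :: "'a :: real_normed_vector set"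
  assumes "open F" "W \<in> components F" "y \<in> frontier W"
  shows "y \<notin> F"
proof
  assume y: "y \<in> F"
  have oW: "open W" using assms open_components by blast
  define C where "C = connected_component_set F y"
  have C: "C \<in> components F" "open C" "y \<in> C"
    using y assms(1) by (auto simp: C_def components_def open_connected_component)
  have "y \<in> closure W" using assms(3) by (simp add: frontier_def)
  then have "C \<inter> W \<noteq> {}" using C(2,3) by (meson disjoint_iff closure_iff_nhds_not_empty order_refl)
  then have "C = W" using components_eq C(1) assms(2) by blast
  then show False using C(3) oW assms(3) by (simp add: frontier_def interior_open)
qed

text \<open>A ball that left \<open>W\<close> would, being connected, meet the frontier of
  \<open>W\<close>. If the frontier is empty, \<open>infdist\<close> is 0 by convention and the ball
  is empty.\<close>

lemma ball_infdist_frontier_subset: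
  fixes W :: "'a :: real_normed_vector set"
  assumes "w \<in> W"
  shows "ball w (infdist w (frontier W)) \<subseteq> W"
proof (rule ccontr)
  let ?B = "ball w (infdist w (frontier W))"
  assume n: "\<not> ?B \<subseteq> W"
  then obtain x where x: "x \<in> ?B" "x \<notin> W" by blast
  then have "infdist w (frontier W) > 0" using zero_le_dist[of w x] unfolding mem_ball by linarith
  then have "w \<in> ?B \<inter> W" using assms by simp
  with x have "?B \<inter> frontier W \<noteq> {}"
    by (intro connected_Int_frontier connected_ball) blast+
  then obtain y where y: "y \<in> ?B" "y \<in> frontier W" by blast
  then show False using infdist_le[OF y(2), of w] by simp
qed

text \<open>If \<open>p\<close> is outside \<open>W\<close>, the segment from \<open>w\<close> to
  \<open>p\<close> leaves the ball at a point \<open>u\<close>, which lies in the closure of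
  \<open>W\<close> and within \<open>c * d\<close> of \<open>p\<close>.\<close>

lemma infdist_le_dist_diff:
  fixes W :: "'a :: real_normed_vector set"
  assumes d: "ball w d \<subseteq> W" "d > 0" and p: "dist w p < (1 + c) * d" and c: "c > 0"
  shows "infdist p W \<le> c * d"
proof (cases "p \<in> W")
  case True
  then show ?thesis using c d(2) by simp
next
  case False
  then have dp: "dist w p \<ge> d" using d(1) by (metis linorder_not_less mem_ball subsetD)
  define u where "u = w + (d / dist w p) *\<^sub>R (p - w)"
  have dw: "dist w p > 0" using dp d(2) by linarith
  have "dist w u = d" using dw d(2) by (simp add: u_def dist_norm norm_minus_commute)
  then have "u \<in> closure (ball w d)" using d(2) by (simp add: closure_ball)
  then have "u \<in> closure W" using d(1) closure_mono by blast
  have "p - u = (1 - d / dist w p) *\<^sub>R (p - w)" by (simp add: u_def algebra_simps)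
  then have "dist p u = \<bar>1 - d / dist w p\<bar> * norm (p - w)" by (simp add: dist_norm)
  also have "\<dots> = (1 - d / dist w p) * dist w p"
    using dp dw by (simp add: dist_norm norm_minus_commute)
  also have "\<dots> = dist w p - d" using dw by (simp add: field_simps)
  finally have "dist p u \<le> c * d" using p by (simp add: algebra_simps)
  moreover have "infdist p W \<le> dist p u"
  proof -
    have "infdist u W = 0" using in_closure_iff_infdist_zero[of W u] d by (metis \<open>u \<in> closure W\<close> ball_eq_empty not_less subset_empty)
    then show ?thesis using infdist_triangle[of p W u] by simp
  qed
  ultimately show ?thesis by linarith
qed

section \<open>Choice of the postsingular points\<close>

theorem theoremB:
  fixes f :: "complex \<Rightarrow> complex" and U :: "complex set" and W :: "nat \<Rightarrow> complex set"
  assumes "f nicely_meromorphic_on UNIV"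
    and "transcendental f"
    and "U \<in> components (fatou_set f)"
    and "\<And>n. W n \<in> components (fatou_set f)"
    and "\<And>n. iter f n ` U \<subseteq> Some ` W n"
  shows "\<forall>z\<in>U.
    (\<exists>p :: nat \<Rightarrow> complex.
       (\<forall>n. p n \<in> postsingular_set f) \<and>
       (\<lambda>n. infdist (p n) (W n) / infdist (the (iter f n z)) (frontier (W n))) \<longlonglongrightarrow> 0 \<and>
       ((\<exists>d>0. \<forall>n. infdist (the (iter f n z)) (frontier (W n)) < d) \<longrightarrow>
          (\<lambda>n. infdist (p n) (W n)) \<longlonglongrightarrow> 0)) \<and>
    ((\<exists>D. \<forall>n. bounded (W n) \<and> diameter (W n) \<le> D) \<longrightarrow>
       (\<exists>d>0. \<forall>n. infdist (the (iter f n z)) (frontier (W n)) < d))"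
proof (intro ballI conjI)
  fix z assume zU: "z \<in> U"
  note f = assms(1)
  define P where "P = postsingular_set f"
  define F where "F = fatou_set f"
  define w where "w n = the (iter f n z)" for n
  define d where "d n = infdist (w n) (frontier (W n))" for n
  have oF: "open F" unfolding F_def by (rule open_fatou_set)
  have WF: "W n \<in> components F" for n using assms(4) by (simp add: F_def)
  have oW: "open (W n)" for n using open_components[OF oF WF] .
  have zF: "z \<in> fatou_set f" using zU assms(3) in_components_subset by blast
  have iw: "iter f n z = Some (w n) \<and> w n \<in> W n" for n
  proof -
    have "iter f n z \<in> Some ` W n" using assms(5) zU by blast
    then show ?thesis by (auto simp: w_def)
  qed
  have d0: "d n \<ge> 0" for n by (simp add: d_def infdist_nonneg)
  \<comment> \<open>The case of empty frontier is carried along: then \<open>W n\<close> is the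
    whole plane, \<open>d n = 0\<close> by the convention for \<open>infdist\<close>, and the
    quotient in question is 0.\<close>
  have empty: "W n = UNIV" if "frontier (W n) = {}" for n
    using that iw[of n] frontier_eq_empty by blast
  have ne: "\<exists>y. y \<in> frontier (W n) \<and> d n = dist (w n) y \<and> d n > 0" if fr: "frontier (W n) \<noteq> {}" for n
  proof -
    obtain y where y: "y \<in> frontier (W n)" "d n = dist (w n) y"
      using infdist_attains_inf[OF frontier_closed[of "W n"] fr, of "w n"] unfolding d_def by blast
    moreover have "w n \<noteq> y" using y(1) iw[of n] oW[of n] by (auto simp: frontier_def interior_open)
    ultimately show ?thesis by auto
  qed
  have dz: "infdist p (W n) = 0" if "d n = 0" for n p
  proof -
    have "W n = UNIV" using empty ne[of n] that by force
    then show ?thesis by simp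
  qed
  \<comment> \<open>With \<open>R = (1 + c) * d n\<close> and \<open>\<theta> = 1 / (1 + c)\<close>,
    a nearest boundary point has distance \<open>\<theta> * R\<close> from \<open>w n\<close>, while
    a postsingular point in the disc of radius \<open>R\<close> is within \<open>c * d n\<close> of
    \<open>W n\<close>.\<close>
  have near: "eventually (\<lambda>n. d n = 0 \<or> (\<exists>p\<in>P. infdist p (W n) \<le> c * d n)) sequentially" if c: "c > 0" for c
  proof -
    have "1 / (1 + c) < 1" using c by simp
    from no_large_pullbacks[OF f assms(2) zF _ this, of w] iw
    have "eventually (\<lambda>n. \<not> (\<exists>R y. R > 0 \<and> ball (w n) R \<inter> P = {} \<and>
      dist (w n) y \<le> 1 / (1 + c) * R \<and> y \<notin> F)) sequentially" unfolding P_def F_def by simp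
    then show ?thesis
    proof eventually_elim
      case (elim n)
      show ?case
      proof (rule ccontr)
        assume far: "\<not> (d n = 0 \<or> (\<exists>p\<in>P. infdist p (W n) \<le> c * d n))"
        then have "frontier (W n) \<noteq> {}" by (auto simp: d_def infdist_def)
        from ne[OF this] obtain y where y: "y \<in> frontier (W n)" "d n = dist (w n) y" "d n > 0" by blast
        have "ball (w n) ((1 + c) * d n) \<inter> P = {}"
        proof (rule ccontr)
          assume "ball (w n) ((1 + c) * d n) \<inter> P \<noteq> {}"
          then obtain p where p: "dist (w n) p < (1 + c) * d n" "p \<in> P" by auto
          have "ball (w n) (d n) \<subseteq> W n"
            unfolding d_def using iw ball_infdist_frontier_subset by blast
          from infdist_le_dist_diff[OF this y(3) p(1) c] far p(2) show False by blast
        qed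
        moreover have "y \<notin> F" using frontier_component_disjoint[OF oF WF y(1)] .
        moreover have "(1 + c) * d n > 0" using c y(3) by simp
        moreover have "dist (w n) y \<le> 1 / (1 + c) * ((1 + c) * d n)" using c y(2) by simp
        ultimately show False using elim by blast
      qed
    qed
  qed
  obtain a where a: "a \<in> P" using postsingular_set_two_points[OF f assms(2)] unfolding P_def by blast
  \<comment> \<open>One sequence has to serve all \<open>c\<close>, and the infimum of the distances
    need not be attained. So \<open>p n\<close> is nearly closest to \<open>W n\<close>, up to an
    error that is negligible against \<open>d n\<close>.\<close>
  have "\<exists>p\<in>P. \<forall>p'\<in>P. infdist p (W n) \<le> infdist p' (W n) + d n / real (Suc n)" for n
  proof (cases "d n = 0")
    case True
    then show ?thesis using a dz[OF True] by auto
  next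
    case False
    then have pos: "d n / real (Suc n) > 0" using d0[of n] by simp
    let ?I = "(\<lambda>p. infdist p (W n)) ` P"
    have bdd: "bdd_below ?I" by (rule bdd_belowI[of _ 0]) (auto simp: infdist_nonneg)
    have "Inf ?I < Inf ?I + d n / real (Suc n)" using pos by simp
    from cInf_lessD[OF _ this] a obtain p where p: "p \<in> P" "infdist p (W n) < Inf ?I + d n / real (Suc n)" by auto
    have "Inf ?I \<le> infdist p' (W n)" if "p' \<in> P" for p' by (rule cInf_lower[OF _ bdd]) (use that in auto)
    then have "infdist p (W n) \<le> infdist p' (W n) + d n / real (Suc n)" if "p' \<in> P" for p'
      using p(2) that by fastforce
    then show ?thesis using p(1) by blast
  qed
  then obtain p where p: "\<And>n. p n \<in> P" "\<And>n p'. p' \<in> P \<Longrightarrow> infdist (p n) (W n) \<le> infdist p' (W n) + d n / real (Suc n)"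
    by metis
  define q where "q n = infdist (p n) (W n) / d n" for n
  have q0: "q n \<ge> 0" for n using d0 by (simp add: q_def infdist_nonneg)
  have qlim: "q \<longlonglongrightarrow> 0"
  proof (rule LIMSEQ_I)
    fix e :: real assume e: "e > 0"
    have "(\<lambda>n. 1 / real (Suc n)) \<longlonglongrightarrow> 0" using LIMSEQ_inverse_real_of_nat by (simp add: inverse_eq_divide)
    then have "eventually (\<lambda>n. 1 / real (Suc n) < e / 2) sequentially"
      by (rule order_tendstoD(2)) (use e in simp)
    moreover have "eventually (\<lambda>n. d n = 0 \<or> (\<exists>p\<in>P. infdist p (W n) \<le> e / 2 * d n)) sequentially"
      by (rule near) (use e in simp)
    ultimately have "eventually (\<lambda>n. norm (q n - 0) < e) sequentially"
    proof eventually_elim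
      case (elim n)
      show ?case
      proof (cases "d n = 0")
        case True
        then show ?thesis using e by (simp add: q_def)
      next
        case False
        then have dn: "d n > 0" using d0[of n] by simp
        obtain p' where "p' \<in> P" "infdist p' (W n) \<le> e / 2 * d n" using elim(2) False by blast
        then have "infdist (p n) (W n) \<le> e / 2 * d n + d n / real (Suc n)"
          using p(2)[of p' n] by linarith
        also have "\<dots> = (e / 2 + 1 / real (Suc n)) * d n" by (simp add: algebra_simps)
        also have "\<dots> < e * d n" using dn elim(1) by (intro mult_strict_right_mono) auto
        finally have "q n < e" using dn by (simp add: q_def pos_divide_less_eq)
        then show ?thesis using q0[of n] by simp
      qed
    qed
    then show "\<exists>N. \<forall>n\<ge>N. norm (q n - 0) < e" by (simp add: eventually_sequentially)
  qed
  have bdd: "(\<lambda>n. infdist (p n) (W n)) \<longlonglongrightarrow> 0" if D: "\<forall>n. d n < D" for D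
  proof (rule real_tendsto_sandwich[of "\<lambda>n. 0" _ _ "\<lambda>n. q n * D"])
    have "infdist (p n) (W n) \<le> q n * D" for n
    proof -
      \<comment> \<open>For \<open>d n = 0\<close> the quotient \<open>q n\<close> is 0 by the
        convention on division, but so is the distance, by \<open>dz\<close>.\<close>
      have "infdist (p n) (W n) = q n * d n" using dz[of n "p n"] by (cases "d n = 0") (auto simp: q_def)
      also have "\<dots> \<le> q n * D" using D q0[of n] by (intro mult_left_mono) (auto intro: less_imp_le)
      finally show ?thesis .
    qed
    then show "\<forall>\<^sub>F n in sequentially. infdist (p n) (W n) \<le> q n * D" by simp
    show "(\<lambda>n. q n * D) \<longlonglongrightarrow> 0" using tendsto_mult_right[OF qlim, of D] by simp
  qed (auto simp: infdist_nonneg)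
  show "\<exists>p. (\<forall>n. p n \<in> postsingular_set f) \<and>
       (\<lambda>n. infdist (p n) (W n) / infdist (the (iter f n z)) (frontier (W n))) \<longlonglongrightarrow> 0 \<and>
       ((\<exists>d>0. \<forall>n. infdist (the (iter f n z)) (frontier (W n)) < d) \<longrightarrow>
          (\<lambda>n. infdist (p n) (W n)) \<longlonglongrightarrow> 0)"
    using p(1) qlim bdd unfolding P_def q_def d_def w_def by (intro exI[of _ p]) blast
  show "(\<exists>D. \<forall>n. bounded (W n) \<and> diameter (W n) \<le> D) \<longrightarrow>
       (\<exists>d>0. \<forall>n. infdist (the (iter f n z)) (frontier (W n)) < d)"
  proof
    assume "\<exists>D. \<forall>n. bounded (W n) \<and> diameter (W n) \<le> D"
    then obtain D where D: "\<And>n. bounded (W n)" "\<And>n. diameter (W n) \<le> D" by blast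
    \<comment> \<open>The absolute value and the added 1 make the bound positive and strict.\<close>
    have "d n < \<bar>D\<bar> + 1" for n
    proof (cases "frontier (W n) = {}")
      case True
      then show ?thesis by (simp add: d_def infdist_def)
    next
      case False
      from ne[OF this] obtain y where y: "y \<in> frontier (W n)" "d n = dist (w n) y" by blast
      have "w n \<in> closure (W n)" "y \<in> closure (W n)"
        using iw[of n] closure_subset y(1) by (auto simp: frontier_def)
      then have "d n \<le> diameter (W n)"
        using diameter_bounded_bound[of "closure (W n)" "w n" y] D(1)[of n] y(2) bounded_closure[of "W n"]
        by (simp add: diameter_closure)
      then show ?thesis using D(2)[of n] by linarith
    qed
    then show "\<exists>d>0. \<forall>n. infdist (the (iter f n z)) (frontier (W n)) < d"
      unfolding d_def w_def by (intro exI[of _ "\<bar>D\<bar> + 1"]) simp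
  qed
qed

end
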